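(* Let $E$ be an open subset of $\mathbb R^d$ with Lebesgue measure and let $\mathbb P$ be a rigid point process on $E$ satisfying the following two assumptions. (A) $\mathbb P$ admits correlation measures of all orders, and for any $l>0$ the $l$-th correlation measure has the form $\rho_l(p_1,\dots,p_l)\,dp_1\cdots dp_l$, where $\rho_l$ is a symmetric continuous function on $E^l$. (B) There exists a Borel subset $\mathscr W\subset\mathrm{Conf}(E)$, belonging to the tail $\sigma$-algebra of $\mathrm{Conf}(E)$, and, for any $l>0$, a Borel measurable function $\Psi(p_1,\dots,p_l;q_1,\dots,q_l;X)$, defined for $X\in\mathscr W$ and any two distinct $l$-tuples of points not containing particles of $X$, such that: (1) $\mathbb P(\mathscr W)=1$; (2) for fixed $X$, $\Psi(p_1,\dots,p_l;q_1,\dots,q_l;X)$ is continuous in $(p_1,\dots,p_l)\in\mathrm{Conf}_l(E\setminus X)$, $(q_1,\dots,q_l)\in\mathrm{Conf}_l(E\setminus X)$; (3) for fixed $X$ and any three $l$-tuples $(p_1,\dots,p_l),(q_1,\dots,q_l),(r_1,\dots,r_l)$ in $\mathrm{Conf}_l(E\setminus X)$, $$\Psi(p_1,\dots,p_l;q_1,\dots,q_l;X)=\Psi(p_1,\dots,p_l;r_1,\dots,r_l;X)\,\Psi(r_1,\dots,r_l;q_1,\dots,q_l;X);$$ (4) for $\mathbb P$-almost any $Y\in\mathscr W$, any $l$ distinct particles $p_1,\dots,p_l\in Y$ and Lebesgue-almost any $l$-tuple $(q_1,\dots,q_l)\in\mathrm{Conf}_l(E\setminus Y)$, $$\frac{d\mathbb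 P^{p_1,\dots,p_l}}{d\mathbb P^{q_1,\dots,q_l}}\big(Y\setminus\{p_1,\dots,p_l\}\big)=\Psi\big(p_1,\dots,p_l;q_1,\dots,q_l;Y\setminus\{p_1,\dots,p_l\}\big).$$ Let $I\subset E$ be a precompact open subset and let $l\in\mathbb N$ be such that $\mathbb P(\{X:\#_I(X)=l\})>0$. Then, for $\mathbb P$-almost every $X\in\mathrm{Conf}(E)$ such that $\#_I(X)=l$ and almost any distinct points $q_1,\dots,q_l\in E$, the conditional measure $\mathbb P(\cdot\,|\,X;E\setminus I)$ (a measure on $\mathrm{Conf}_l(I)$) has the form $$Z_{q_1,\dots,q_l}^{-1}\,\Psi(p_1,\dots,p_l;q_1,\dots,q_l;X|_{E\setminus I})\,\rho_l(p_1,\dots,p_l)\,dp_1\cdots dp_l,$$ where $Z_{q_1,\dots,q_l}$ is the normalization constant.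
   Context: $\mathrm{Conf}(E)$ is the space of (locally finite) configurations on $E$; a point process on $E$ is a Borel probability measure on $\mathrm{Conf}(E)$; $\mathrm{Conf}_l(C)$ is the space of subsets of $C$ of cardinality $l$; $X|_C$ is the restriction of $X$ to $C$; $\#_B(X)$ is the number of particles of $X$ in $B$. For $C\subset E$, $\mathcal F_C$ is the $\sigma$-algebra generated by all $\#_B$, $B\subset C$, and $\mathcal F_C^{\mathbb P}$ is its $\mathbb P$-completion. The tail $\sigma$-algebra is the intersection of $\mathcal F_{E\setminus B}$ over all compact $B\subset E$. $\mathbb P$ is rigid if for every compact $B\subset E$ the function $\#_B$ is $\mathcal F^{\mathbb P}_{E\setminus B}$-measurable. The measure $\mathbb P(\cdot\,|\,X;C)$ on $\mathrm{Conf}(E\setminus C)$ is the conditional measure (in the sense of Rohlin) of $\mathbb P$ with respect to the restriction map $X\mapsto X|_C$, $\mathrm{Conf}(E)\to\mathrm{Conf}(C)$, whose fibres are identified with $\mathrm{Conf}(E\setminus C)$. By rigidity, $\mathbb P(\cdot\,|\,X;E\setminus I)$ is supported on $\mathrm{Conf}_l(I)$ with $l=\#_I(X)$. The reduced Palm measures $\mathbb P^{q_1,\dots,q_l}$ are determined by $$\int\sum_{x_1,\dots,x_l\in X\text{ distinct}} f(x_1,\dots,x_l;X\setminus\{x_1,\dots,x_l\})\,d\mathbb P(X)=\int\!\!\int f(q_1,\dots,q_l;X)\,d\mathbb P^{q_1,\dots,q_l}(X)\,\rho_l(q_1,\dots,q_l)\,dq_1\cdots dq_l$$ for nonnegative measurable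 $f$. *)

theory Defs
  imports "HOL-Probability.Probability"
begin

(* Configurations are simple, so they are sets of particles.  conf E C consists of the
   configurations on E all of whose particles lie in C; local finiteness is always meant in E.
   For C = E - I with I open this is the space Conf(C); for a precompact C it is the space of the
   restrictions of configurations on E, which do not accumulate at the boundary of C.
   Conf(E) itself is conf E E. *)
definition conf :: "'a::euclidean_space set \<Rightarrow> 'a set \<Rightarrow> 'a set set" where
  "conf E C = {X. X \<subseteq> E \<inter> C \<and> (\<forall>K. compact K \<longrightarrow> K \<subseteq> E \<longrightarrow> finite (X \<inter> K))}"

definition nparticles :: "'a set \<Rightarrow> 'a set \<Rightarrow> ennreal" where
  "nparticles B X = emeasure (count_space UNIV) (X \<inter> B)"

definition count_algebra :: "'a::euclidean_space set set \<Rightarrow> 'a set \<Rightarrow> 'a set measure" where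
  "count_algebra \<Omega> C =
     sigma \<Omega> {nparticles B -` S \<inter> \<Omega> | B S. B \<in> sets borel \<and> B \<subseteq> C \<and> S \<in> sets borel}"

(* The Borel structure of Conf(C) is the one generated by the particle numbers. *)
definition conf_space :: "'a::euclidean_space set \<Rightarrow> 'a set \<Rightarrow> 'a set measure" where
  "conf_space E C = count_algebra (conf E C) C"

(* The sigma-algebra F_C on Conf(E). *)
definition outer_algebra :: "'a::euclidean_space set \<Rightarrow> 'a set \<Rightarrow> 'a set measure" where
  "outer_algebra E C = count_algebra (conf E E) C"

(* F_C enlarged by all subsets of P-null sets of Conf(E).  The null sets have to be taken in the
   Borel sigma-algebra of Conf(E): completing the restriction of P to F_C alone would make rigidity
   unsatisfiable, since a set of F_C imposes no condition on the particles outside C. *)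
definition completed_algebra ::
    "'a::euclidean_space set \<Rightarrow> 'a set measure \<Rightarrow> 'a set \<Rightarrow> 'a set measure" where
  "completed_algebra E P C =
     sigma (conf E E) (sets (outer_algebra E C) \<union> null_sets (completion P))"

definition tail_algebra :: "'a::euclidean_space set \<Rightarrow> 'a set set set" where
  "tail_algebra E = (\<Inter>K\<in>{K. compact K \<and> K \<subseteq> E}. sets (outer_algebra E (E - K)))"

definition point_process :: "'a::euclidean_space set \<Rightarrow> 'a set measure \<Rightarrow> bool" where
  "point_process E P \<longleftrightarrow> prob_space P \<and> sets P = sets (conf_space E E)"

definition rigid :: "'a::euclidean_space set \<Rightarrow> 'a set measure \<Rightarrow> bool" where
  "rigid E P \<longleftrightarrow> (\<forall>B. compact B \<longrightarrow> B \<subseteq> E \<longrightarrow>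
     nparticles B \<in> borel_measurable (completed_algebra E P (E - B)))"

(* An l-tuple is an extensional function on {..<l}; conf_tuples l C are the orderings of the
   elements of Conf_l(C). *)
definition conf_tuples :: "nat \<Rightarrow> 'a set \<Rightarrow> (nat \<Rightarrow> 'a) set" where
  "conf_tuples l C = {p \<in> {..<l} \<rightarrow>\<^sub>E C. inj_on p {..<l}}"

(* Lebesgue measure dp_1 ... dp_l on C^l, and on its subset of tuples of distinct points. *)
definition leb_tuples :: "nat \<Rightarrow> 'a::euclidean_space set \<Rightarrow> (nat \<Rightarrow> 'a) measure" where
  "leb_tuples l C = PiM {..<l} (\<lambda>_. restrict_space lborel C)"

definition leb_conf_tuples :: "nat \<Rightarrow> 'a::euclidean_space set \<Rightarrow> (nat \<Rightarrow> 'a) measure" where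
  "leb_conf_tuples l C = restrict_space (leb_tuples l C) (conf_tuples l C)"

definition correlation_measure ::
    "'a::euclidean_space set \<Rightarrow> 'a set measure \<Rightarrow> nat \<Rightarrow> (nat \<Rightarrow> 'a) measure \<Rightarrow> bool" where
  "correlation_measure E P l \<mu> \<longleftrightarrow>
     sets \<mu> = sets (leb_tuples l E) \<and>
     (\<forall>A\<in>sets \<mu>. emeasure \<mu> A =
        (\<integral>\<^sup>+X. emeasure (count_space UNIV) (conf_tuples l X \<inter> A) \<partial>P)) \<and>
     (\<forall>K. compact K \<longrightarrow> K \<subseteq> E \<longrightarrow> emeasure \<mu> ({..<l} \<rightarrow>\<^sub>E K) < \<infinity>)"

(* Q is a version of the family q \<mapsto> P^q of reduced Palm measures of order l, given the density
   rho of the l-th correlation measure.  The values Q q with rho q = 0 are arbitrary. *)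
definition reduced_palm ::
    "'a::euclidean_space set \<Rightarrow> 'a set measure \<Rightarrow> nat \<Rightarrow> ((nat \<Rightarrow> 'a) \<Rightarrow> real) \<Rightarrow>
     ((nat \<Rightarrow> 'a) \<Rightarrow> 'a set measure) \<Rightarrow> bool" where
  "reduced_palm E P l \<rho> Q \<longleftrightarrow>
     Q \<in> leb_tuples l E \<rightarrow>\<^sub>M prob_algebra (conf_space E E) \<and>
     (\<forall>f :: (nat \<Rightarrow> 'a) \<times> 'a set \<Rightarrow> ennreal.
        f \<in> borel_measurable (leb_tuples l E \<Otimes>\<^sub>M conf_space E E) \<longrightarrow>
        (\<integral>\<^sup>+X. (\<integral>\<^sup>+x. f (x, X - x ` {..<l}) \<partial>count_space (conf_tuples l X)) \<partial>P) =
        (\<integral>\<^sup>+q. (\<integral>\<^sup>+X. f (q, X) \<partial>Q q) * ennreal (\<rho> q) \<partial>leb_tuples l E))"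

(* f is a version of dN/dM, for probability measures N and M. *)
definition RN_version :: "'b measure \<Rightarrow> 'b measure \<Rightarrow> ('b \<Rightarrow> real) \<Rightarrow> bool" where
  "RN_version M N f \<longleftrightarrow>
     absolutely_continuous M N \<and> (AE x in M. f x = enn2real (RN_deriv M N x))"

(* dP^p/dP^q (Y - p) = Psi p q (Y - p) for P-almost every Y, all tuples p of distinct particles of Y
   and almost every q.  Evaluating a Radon-Nikodym derivative at a point requires a choice of
   version, and the derivatives for different p, q are only comparable pointwise if the versions
   depend measurably on (p, q).  Therefore the derivatives are taken from some jointly measurable
   version D; the function RN_deriv chooses independently for every p and q.  Where rho q = 0
   the measure P^q is undetermined, so such q are exempt. *)
definition palm_derivative ::
    "'a::euclidean_space set \<Rightarrow> 'a set measure \<Rightarrow> nat \<Rightarrow> ((nat \<Rightarrow> 'a) \<Rightarrow> real) \<Rightarrow>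
     ((nat \<Rightarrow> 'a) \<Rightarrow> 'a set measure) \<Rightarrow>
     ((nat \<Rightarrow> 'a) \<Rightarrow> (nat \<Rightarrow> 'a) \<Rightarrow> 'a set \<Rightarrow> real) \<Rightarrow> bool" where
  "palm_derivative E P l \<rho> Q \<Psi> \<longleftrightarrow>
     (\<exists>D :: (nat \<Rightarrow> 'a) \<Rightarrow> (nat \<Rightarrow> 'a) \<Rightarrow> 'a set \<Rightarrow> real.
        (\<lambda>(p, q, Z). D p q Z)
          \<in> borel_measurable (leb_tuples l E \<Otimes>\<^sub>M leb_tuples l E \<Otimes>\<^sub>M conf_space E E) \<and>
        (AE Y in P. \<forall>p\<in>conf_tuples l Y. AE q in leb_tuples l E.
           q \<in> conf_tuples l (E - Y) \<longrightarrow> \<rho> q > 0 \<longrightarrow>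
             RN_version (Q q) (Q p) (D p q) \<and>
             D p q (Y - p ` {..<l}) = \<Psi> p q (Y - p ` {..<l})))"

(* \<kappa> is a version of the conditional measures of P with respect to X \<mapsto> X \<inter> C.  The fibre of
   this map over \<xi> is identified with conf E (E - C) by Y \<mapsto> Y \<union> \<xi>; thus \<kappa> (X \<inter> C) is P(.|X;C). *)
definition conditional_measures ::
    "'a::euclidean_space set \<Rightarrow> 'a set measure \<Rightarrow> 'a set \<Rightarrow> ('a set \<Rightarrow> 'a set measure) \<Rightarrow> bool" where
  "conditional_measures E P C \<kappa> \<longleftrightarrow>
     \<kappa> \<in> conf_space E C \<rightarrow>\<^sub>M prob_algebra (conf_space E (E - C)) \<and>
     (\<forall>A\<in>sets P. emeasure P A =
        (\<integral>\<^sup>+X. emeasure (\<kappa> (X \<inter> C)) {Y \<in> conf E (E - C). Y \<union> (X \<inter> C) \<in> A} \<partial>P))"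

end

(* The joint law of (X Int (E - I), X Int I) on the event #_I = l is read off the Palm formula: it
   is (1/l!) rho(p) dp P^p restricted to configurations without particles in I.  Fixing one
   reference tuple q and writing P^p = Psi(p, q, .) P^q turns it into a measure nu(dxi) with density
   proportional to Psi(p, q, xi) rho(p) dp in the second coordinate; disintegrating gives the
   conditional law of X Int I given X Int (E - I) on the event #_I = l.  By rigidity this event is,
   up to a null set, determined by X Int (E - I), so the law found is the conditional measure of P
   itself.  The cocycle property makes the normalised density independent of the reference tuple. *)
theory Submission
  imports Defs
begin

text \<open>The hypothesis on \<Psi> speaks about configurations seen from \<open>P^p\<close>,
  whereas the computation integrates against the single measure \<open>P^q\<close>; passing from one
  to the other is the delicate point. Most of the remaining work exchanges almost-everywhere
  quantifiers. It rests on the fact that countably many counting events generate the sigma-algebra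
  of configurations: equality of two measures is then a countable conjunction, measurable in its
  parameters, and Fubini applies. A usable reference tuple exists because the positive probability
  of the event forces \<rho> to be positive on a non-null set of tuples. The factor
  \<open>l!\<close> counts the orderings of the particles in \<open>I\<close>. Rigidity concerns
  compact sets, so the number of particles in the open set \<open>I\<close> is obtained from
  \<open>closure I\<close> by subtracting the particles on the boundary, which belong to the outer
  configuration. The normaliser is finite because its integral against \<nu> is the probability of
  the event, and nonzero almost surely on the event because it is itself the density of the outer
  law.\<close>

section \<open>Countable generators closed under intersection\<close>

lemma countable_Int_stable_generator:
  assumes "countable G" "G \<subseteq> Pow \<Omega>"
  obtains H where "countable H" "G \<subseteq> H" "H \<subseteq> Pow \<Omega>" "Int_stable H" "\<Omega> \<in> H"
    "sigma_sets \<Omega> H = sigma_sets \<Omega> G"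
proof
  \<comment> \<open>The empty family contributes \<Omega>, so the generator contains the whole space
    and a constant sequence can serve as the exhausting one when measures are compared on
    it.\<close>
  let ?H = "(\<lambda>F. \<Omega> \<inter> \<Inter>F) ` {F. finite F \<and> F \<subseteq> G}"
  show "countable ?H"
    using countable_Collect_finite_subset[OF assms(1)] by simp
  show G: "G \<subseteq> ?H"
  proof
    fix g assume "g \<in> G"
    then show "g \<in> ?H"
      using assms(2) by (intro image_eqI[of _ _ "{g}"]) auto
  qed
  show "?H \<subseteq> Pow \<Omega>" by auto
  show "Int_stable ?H"
  proof (rule Int_stableI)
    fix a b assume "a \<in> ?H" "b \<in> ?H"
    then obtain F F' where F: "finite F" "F \<subseteq> G" "a = \<Omega> \<inter> \<Inter>F"
      "finite F'" "F' \<subseteq> G" "b = \<Omega> \<inter> \<Inter>F'" by auto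
    then show "a \<inter> b \<in> ?H"
      by (intro image_eqI[of _ _ "F \<union> F'"]) auto
  qed
  show "\<Omega> \<in> ?H" by (intro image_eqI[of _ _ "{}"]) auto
  show "sigma_sets \<Omega> ?H = sigma_sets \<Omega> G"
  proof (intro subset_antisym sigma_sets_mono subsetI)
    interpret sigma_algebra \<Omega> "sigma_sets \<Omega> G"
      using assms(2) by (rule sigma_algebra_sigma_sets)
    fix a assume "a \<in> ?H"
    then obtain F where F: "finite F" "F \<subseteq> G" "a = \<Omega> \<inter> \<Inter>F" by auto
    from F(1,2) have "\<Omega> \<inter> \<Inter>F \<in> sigma_sets \<Omega> G"
    proof (induction F)
      case empty then show ?case by (simp add: sigma_sets_top)
    next
      case (insert x F)
      have "\<Omega> \<inter> \<Inter>(insert x F) = x \<inter> (\<Omega> \<inter> \<Inter>F)" by auto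
      then show ?case using insert by (auto intro!: Int)
    qed
    then show "a \<in> sigma_sets \<Omega> G" using F by simp
  next
    fix a assume "a \<in> G"
    then show "a \<in> sigma_sets \<Omega> ?H" using G by blast
  qed
qed

section \<open>Configurations\<close>

lemma conf_subset: "X \<in> conf E C \<Longrightarrow> X \<subseteq> E \<inter> C"
  by (simp add: conf_def)

lemma conf_finite: "X \<in> conf E C \<Longrightarrow> compact K \<Longrightarrow> K \<subseteq> E \<Longrightarrow> finite (X \<inter> K)"
  by (simp add: conf_def)

lemma conf_mono: "Y \<subseteq> X \<Longrightarrow> X \<in> conf E C \<Longrightarrow> Y \<subseteq> C' \<Longrightarrow> Y \<in> conf E C'"
  unfolding conf_def mem_Collect_eq
proof (intro conjI allI impI)
  assume "Y \<subseteq> X" and X: "X \<subseteq> E \<inter> C \<and> (\<forall>K. compact K \<longrightarrow> K \<subseteq> E \<longrightarrow> finite (X \<inter> K))" and "Y \<subseteq> C'"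
  then show "Y \<subseteq> E \<inter> C'" by auto
  fix K assume "compact K" "K \<subseteq> E"
  with X have "finite (X \<inter> K)" by simp
  then show "finite (Y \<inter> K)" by (rule rev_finite_subset) (use \<open>Y \<subseteq> X\<close> in auto)
qed

lemma nparticles_Int: "nparticles B (X \<inter> C) = nparticles (B \<inter> C) X"
  by (simp add: nparticles_def Int_ac)

lemma nparticles_eq_0_iff: "nparticles B X = 0 \<longleftrightarrow> X \<inter> B = {}"
  by (simp add: nparticles_def emeasure_count_space_eq_0)

lemma nparticles_eq_of_nat_iff:
  "nparticles B X = of_nat n \<longleftrightarrow> finite (X \<inter> B) \<and> card (X \<inter> B) = n"
  unfolding nparticles_def
  by (cases "finite (X \<inter> B)") (auto simp flip: ennreal_of_nat_eq_real_of_nat)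

lemma nparticles_finite: "finite (X \<inter> B) \<Longrightarrow> nparticles B X = of_nat (card (X \<inter> B))"
  by (simp add: nparticles_eq_of_nat_iff)

lemma nparticles_suminf:
  assumes "disjoint_family A"
  shows "nparticles (\<Union>i. A i) X = (\<Sum>i. nparticles (A i) X)"
proof -
  have "disjoint_family (\<lambda>i. X \<inter> A i)"
    using assms by (auto simp: disjoint_family_on_def)
  then have "(\<Sum>i. emeasure (count_space UNIV) (X \<inter> A i)) = emeasure (count_space UNIV) (\<Union>i. X \<inter> A i)"
    by (intro suminf_emeasure) auto
  then show ?thesis unfolding nparticles_def Int_UN_distrib by (rule sym)
qed

lemma nparticles_Un:
  "A \<inter> B = {} \<Longrightarrow> nparticles (A \<union> B) X = nparticles A X + nparticles B X"
  unfolding nparticles_def Int_Un_distrib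
  by (rule plus_emeasure[symmetric]) auto

section \<open>The Borel structure generated by the particle numbers\<close>

lemma space_conf_space [simp]: "space (conf_space E C) = conf E C"
  by (simp add: conf_space_def count_algebra_def space_measure_of_conv)

lemma sets_count_algebra: "sets (count_algebra \<Omega> C) =
    sigma_sets \<Omega> {nparticles B -` S \<inter> \<Omega> | B S. B \<in> sets borel \<and> B \<subseteq> C \<and> S \<in> sets borel}"
  unfolding count_algebra_def by (rule sets_measure_of) auto

lemma measurable_nparticles_count_algebra:
  "B \<in> sets borel \<Longrightarrow> B \<subseteq> C \<Longrightarrow> nparticles B \<in> borel_measurable (count_algebra \<Omega> C)"
  unfolding measurable_def sets_count_algebra
  by (auto simp: count_algebra_def space_measure_of_conv intro!: sigma_sets.Basic)

text \<open>A configuration in \<open>C\<close> sees only \<open>B \<inter> C\<close>, so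
  \<open>B\<close> may be any Borel set although the generators use subsets of
  \<open>C\<close>.\<close>

lemma measurable_nparticles [measurable]:
  assumes [measurable]: "B \<in> sets borel" "C \<in> sets borel"
  shows "nparticles B \<in> borel_measurable (conf_space E C)"
proof -
  have "nparticles (B \<inter> C) \<in> borel_measurable (conf_space E C)"
    unfolding conf_space_def by (rule measurable_nparticles_count_algebra) auto
  moreover have "nparticles (B \<inter> C) X = nparticles B X" if "X \<in> conf E C" for X
    using conf_subset[OF that] by (auto simp: nparticles_def intro!: arg_cong[where f="emeasure _"])
  ultimately show ?thesis
    by (subst measurable_cong[where g="nparticles (B \<inter> C)"]) auto
qed

lemma measurable_conf_spaceI:
  assumes "\<And>x. x \<in> space M \<Longrightarrow> f x \<in> conf E C"
    and "\<And>B. B \<in> sets borel \<Longrightarrow> B \<subseteq> C \<Longrightarrow> (\<lambda>x. nparticles B (f x)) \<in> borel_measurable M"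
  shows "f \<in> M \<rightarrow>\<^sub>M conf_space E C"
  unfolding conf_space_def count_algebra_def
proof (rule measurable_measure_of)
  show "f \<in> space M \<rightarrow> conf E C" using assms(1) by auto
  fix y assume "y \<in> {nparticles B -` S \<inter> conf E C |B S. B \<in> sets borel \<and> B \<subseteq> C \<and> S \<in> sets borel}"
  then obtain B S where y: "y = nparticles B -` S \<inter> conf E C" "B \<in> sets borel" "B \<subseteq> C" "S \<in> sets borel"
    by auto
  have "f -` y \<inter> space M = (\<lambda>x. nparticles B (f x)) -` S \<inter> space M"
    using assms(1) by (auto simp: y)
  also have "\<dots> \<in> sets M" using assms(2)[OF y(2,3)] y(4) by (rule measurable_sets)
  finally show "f -` y \<inter> space M \<in> sets M" .
qed auto

lemma conf_Int: "X \<in> conf E D \<Longrightarrow> X \<inter> C \<in> conf E C"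
  by (erule conf_mono[rotated]) auto

lemma measurable_conf_Int [measurable]:
  assumes [measurable]: "C \<in> sets borel" "D \<in> sets borel"
  shows "(\<lambda>X. X \<inter> C) \<in> conf_space E D \<rightarrow>\<^sub>M conf_space E C"
  by (rule measurable_conf_spaceI) (auto intro: conf_Int simp: nparticles_Int)

text \<open>Local finiteness is tested on the compact subsets of \<open>E\<close> whatever
  \<open>C\<close> is, so the inclusion is well defined. It lets outer configurations be inserted
  into functions on Conf(E).\<close>

lemma measurable_conf_incl:
  assumes [measurable]: "C \<in> sets borel" "D \<in> sets borel" and "C \<subseteq> D"
  shows "(\<lambda>X. X) \<in> conf_space E C \<rightarrow>\<^sub>M conf_space E D"
proof (rule measurable_conf_spaceI)
  show "X \<in> conf E D" if "X \<in> space (conf_space E C)" for X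
    using that assms(3) by (auto intro: conf_mono dest: conf_subset)
qed auto

text \<open>Dynkin argument over \<open>B\<close>. The complement step subtracts counts and so needs
  them finite; cutting with \<open>V\<close>, which lies in a compact subset of \<open>E\<close>,
  ensures this.\<close>

lemma nparticles_borel_generated:
  assumes \<B>: "sigma UNIV \<B> = (borel :: 'a::euclidean_space measure)" "Int_stable \<B>" "UNIV \<in> \<B>"
    and V: "V \<in> \<B>" "V \<subseteq> K" "compact K" "K \<subseteq> E" and "C \<in> sets borel" and B: "B \<in> sets borel"
    and sp: "space M = conf E C"
    and meas: "\<And>U. U \<in> \<B> \<Longrightarrow> nparticles (U \<inter> V \<inter> C) \<in> borel_measurable M"
  shows "nparticles (B \<inter> V \<inter> C) \<in> borel_measurable M"
proof -
  have "B \<in> sigma_sets UNIV \<B>"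
    using B \<B>(1) by (metis sets_measure_of subset_UNIV Pow_UNIV)
  with \<B>(2) subset_UNIV[of \<B>, folded Pow_UNIV] show ?thesis
  proof (induction rule: sigma_sets_induct_disjoint)
    case (basic A) then show ?case by (rule meas)
  next
    case empty then show ?case by (simp add: nparticles_def)
  next
    case (compl A)
    have fin: "finite (X \<inter> (B' \<inter> V \<inter> C))" if "X \<in> conf E C" for X B'
      using conf_finite[OF that V(3,4)] by (rule rev_finite_subset) (use V(2) in auto)
    have "nparticles ((UNIV - A) \<inter> V \<inter> C) X =
        nparticles (UNIV \<inter> V \<inter> C) X - nparticles (A \<inter> V \<inter> C) X" if "X \<in> conf E C" for X
    proof -
      have "nparticles (UNIV \<inter> V \<inter> C) X =
          nparticles ((UNIV - A) \<inter> V \<inter> C) X + nparticles (A \<inter> V \<inter> C) X"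
        by (subst nparticles_Un[symmetric]) (auto intro!: arg_cong2[where f=nparticles])
      then show ?thesis
        using nparticles_finite[OF fin[OF that]] by simp
    qed
    then show ?case
      using borel_measurable_minus_ennreal[OF meas[OF \<B>(3)] compl(2)]
      by (subst measurable_cong) (auto simp: sp)
  next
    case (union A)
    have "nparticles ((\<Union>i. A i) \<inter> V \<inter> C) X = (\<Sum>i. nparticles (A i \<inter> V \<inter> C) X)" for X
    proof -
      have "disjoint_family (\<lambda>i. A i \<inter> V \<inter> C)"
        using union(1) by (auto simp: disjoint_family_on_def)
      from nparticles_suminf[OF this] show ?thesis
        by (simp add: Int_UN_distrib2)
    qed
    then show ?case using union(3) by simp
  qed
qed

text \<open>Counts in base sets, cut off by base sets inside compact subsets of \<open>E\<close>,
  take natural values, so countably many level sets determine them; every other count is a countable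
  sum of such local ones. The lemma turns equality of two measures on configurations into countably
  many equations, whose exceptional null sets can be united.\<close>

lemma conf_space_countably_generated:
  fixes E C :: "'a::euclidean_space set"
  assumes "open E" and C: "C \<in> sets borel"
  obtains \<G> where "countable \<G>" "\<G> \<subseteq> Pow (conf E C)" "Int_stable \<G>" "conf E C \<in> \<G>"
    "sets (conf_space E C) = sigma_sets (conf E C) \<G>"
proof -
  obtain \<B>0 :: "'a set set" where \<B>0: "countable \<B>0" "topological_basis \<B>0"
    using ex_countable_basis by blast
  obtain \<B> where \<B>: "countable \<B>" "\<B>0 \<subseteq> \<B>" "Int_stable \<B>" "UNIV \<in> \<B>"
      "sigma_sets UNIV \<B> = sigma_sets UNIV \<B>0"
    using countable_Int_stable_generator[OF \<B>0(1), of UNIV] by auto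
  have borel: "sigma UNIV \<B> = borel"
    unfolding borel_eq_countable_basis[OF \<B>0] using \<B>(5) by (intro sigma_eqI) auto
  have \<B>_borel: "U \<in> sets borel" if "U \<in> \<B>" for U
    using that by (subst borel[symmetric]) auto
  define \<V> where "\<V> = {V\<in>\<B>. \<exists>K. compact K \<and> V \<subseteq> K \<and> K \<subseteq> E}"
  have "countable \<V>" using \<B>(1) by (simp add: \<V>_def)
  \<comment> \<open>\<open>U\<close> is the set whose particles are counted, \<open>V\<close> the
    cut-off that makes the count finite; hence only the values \<open>n::nat\<close> have to be
    listed.\<close>
  define \<G>0 where "\<G>0 = (\<lambda>(U, V, n::nat). {X\<in>conf E C. nparticles (U \<inter> V \<inter> C) X = of_nat n}) ` (\<B> \<times> \<V> \<times> UNIV)"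
  have "countable \<G>0" using \<B>(1) \<open>countable \<V>\<close> by (auto simp: \<G>0_def)
  moreover have \<G>0_Pow: "\<G>0 \<subseteq> Pow (conf E C)" by (auto simp: \<G>0_def)
  ultimately obtain \<G> where \<G>: "countable \<G>" "\<G> \<subseteq> Pow (conf E C)" "Int_stable \<G>" "conf E C \<in> \<G>"
    "sigma_sets (conf E C) \<G> = sigma_sets (conf E C) \<G>0"
    by (rule countable_Int_stable_generator)
  define M where "M = sigma (conf E C) \<G>0"
  have spM: "space M = conf E C" and setsM: "sets M = sigma_sets (conf E C) \<G>0"
    using \<G>0_Pow by (auto simp: M_def)
  have fin: "finite (X \<inter> (U \<inter> V \<inter> C))" if X: "X \<in> conf E C" and V: "V \<in> \<V>" for X U V
  proof -
    obtain K where K: "V \<subseteq> K" "compact K" "K \<subseteq> E" using V by (auto simp: \<V>_def)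
    from conf_finite[OF X K(2,3)] show ?thesis
      by (rule rev_finite_subset) (use K(1) in auto)
  qed
  have basic: "nparticles (U \<inter> V \<inter> C) \<in> borel_measurable M" if "U \<in> \<B>" "V \<in> \<V>" for U V
  proof (rule measurableI)
    fix S :: "ennreal set"
    have "nparticles (U \<inter> V \<inter> C) -` S \<inter> space M =
        (\<Union>n\<in>{n::nat. of_nat n \<in> S}. {X\<in>conf E C. nparticles (U \<inter> V \<inter> C) X = of_nat n})"
      using nparticles_finite[OF fin[OF _ that(2)]] by (auto simp: spM)
    also have "\<dots> \<in> sets M"
      unfolding setsM
      by (rule sigma_sets_UNION) (use that in \<open>auto simp: \<G>0_def intro!: sigma_sets.Basic imageI\<close>)
    finally show "nparticles (U \<inter> V \<inter> C) -` S \<inter> space M \<in> sets M" .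
  qed simp
  have local: "nparticles (B \<inter> V \<inter> C) \<in> borel_measurable M" if "B \<in> sets borel" "V \<in> \<V>" for B V
  proof -
    obtain K where K: "V \<in> \<B>" "V \<subseteq> K" "compact K" "K \<subseteq> E" using \<open>V \<in> \<V>\<close> by (auto simp: \<V>_def)
    show ?thesis
      by (rule nparticles_borel_generated[OF borel \<B>(3,4) K C that(1) spM basic[OF _ that(2)]])
  qed
  have cover: "E \<subseteq> \<Union>\<V>"
  proof
    fix x assume "x \<in> E"
    then obtain r where r: "r > 0" "cball x r \<subseteq> E"
      using \<open>open E\<close> open_contains_cball by blast
    from topological_basisE[OF \<B>0(2) open_ball, of x x r] r obtain V
      where "V \<in> \<B>0" "x \<in> V" "V \<subseteq> ball x r" by auto
    then have "V \<in> \<V>" unfolding \<V>_def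
      using \<B>(2) r by (auto intro!: exI[of _ "cball x r"])
    then show "x \<in> \<Union>\<V>" using \<open>x \<in> V\<close> by auto
  qed
  have all: "nparticles B \<in> borel_measurable M" if B: "B \<in> sets borel" for B
  proof (cases "\<V> = {}")
    \<comment> \<open>This case is separate because \<open>from_nat_into\<close> enumerates only
      nonempty sets.\<close>
    case True
    then have "E = {}" using cover by auto
    then have "nparticles B X = 0" if "X \<in> conf E C" for X
      using conf_subset[OF that] by (auto simp: nparticles_eq_0_iff)
    then show ?thesis by (subst measurable_cong[where g="\<lambda>_. 0"]) (auto simp: spM)
  next
    case False
    define v where "v = from_nat_into \<V>"
    have v: "v i \<in> \<V>" for i using from_nat_into[OF False] by (simp add: v_def)
    have "range v = \<V>" using range_from_nat_into[OF False \<open>countable \<V>\<close>] by (simp add: v_def)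
    have v_borel: "v i \<in> sets borel" for i using v \<B>_borel by (auto simp: \<V>_def)
    have d_borel: "disjointed v i \<in> sets borel" for i
      using sets.range_disjointed_sets[of v borel] v_borel by auto
    \<comment> \<open>The cover is made disjoint so that each particle is counted once. The
      intersection with \<open>v i\<close> changes nothing, as \<open>disjointed v i\<close> lies in
      \<open>v i\<close>, and gives the shape that \<open>local\<close> treats.\<close>
    have "nparticles B X = (\<Sum>i. nparticles ((B \<inter> disjointed v i) \<inter> v i \<inter> C) X)" if "X \<in> conf E C" for X
    proof -
      have "disjoint_family (\<lambda>i. (B \<inter> disjointed v i) \<inter> v i \<inter> C)"
        using disjoint_family_disjointed[of v] unfolding disjoint_family_on_def by blast
      from nparticles_suminf[OF this, of X]
      have "(\<Sum>i. nparticles ((B \<inter> disjointed v i) \<inter> v i \<inter> C) X) = nparticles (\<Union>i. (B \<inter> disjointed v i) \<inter> v i \<inter> C) X" ..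
      also have "(\<Union>i. (B \<inter> disjointed v i) \<inter> v i \<inter> C) = (\<Union>i. disjointed v i) \<inter> B \<inter> C"
        using disjointed_subset[of v] by blast
      also have "(\<Union>i. disjointed v i) = \<Union>\<V>" using UN_disjointed_eq[of v] \<open>range v = \<V>\<close> by simp
      also have "nparticles (\<Union>\<V> \<inter> B \<inter> C) X = nparticles B X"
        using conf_subset[OF that] cover
        by (auto simp: nparticles_def intro!: arg_cong[where f="emeasure _"])
      finally show ?thesis ..
    qed
    then show ?thesis
      using local[OF _ v] B d_borel by (subst measurable_cong) (auto simp: spM intro!: borel_measurable_suminf_order)
  qed
  have "sets (conf_space E C) \<subseteq> sets M"
    unfolding conf_space_def sets_count_algebra spM[symmetric]
  proof (rule sets.sigma_sets_subset, rule subsetI)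
    fix g assume "g \<in> {nparticles B -` S \<inter> space M |B S. B \<in> sets borel \<and> B \<subseteq> C \<and> S \<in> sets borel}"
    then show "g \<in> sets M" using measurable_sets[OF all] by blast
  qed
  moreover have "sets M \<subseteq> sets (conf_space E C)"
  proof -
    have "\<G>0 \<subseteq> sets (conf_space E C)"
    proof
      fix g assume "g \<in> \<G>0"
      then obtain U V n where g: "g = {X \<in> space (conf_space E C). nparticles (U \<inter> V \<inter> C) X = of_nat n}"
        "U \<in> \<B>" "V \<in> \<B>" by (auto simp: \<G>0_def \<V>_def)
      have [measurable]: "U \<inter> V \<inter> C \<in> sets borel" using g \<B>_borel C by auto
      note C[measurable]
      show "g \<in> sets (conf_space E C)" unfolding g by measurable
    qed
    from sets.sigma_sets_subset[OF this] show ?thesis by (simp add: setsM)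
  qed
  ultimately show ?thesis
    using that[OF \<G>(1-4)] \<G>(5) setsM by auto
qed

lemma pred_ball_countable:
  assumes "countable I" "\<And>i. i \<in> I \<Longrightarrow> Measurable.pred M (P i)"
  shows "Measurable.pred M (\<lambda>x. \<forall>i\<in>I. P i x)"
  unfolding pred_def
  by (rule sets.sets_Collect_countable_All') (use assms in \<open>auto simp: pred_def\<close>)

text \<open>Around a point of \<open>E\<close> some closed ball lies in \<open>E\<close> and
  contains finitely many particles, so a point outside the configuration has a neighbourhood free of
  particles. Membership thus becomes a condition on counts in base sets.\<close>

lemma mem_conf_iff:
  assumes "open E" "topological_basis \<B>" "Z \<in> conf E C" "x \<in> E"
  shows "x \<in> Z \<longleftrightarrow> (\<forall>U\<in>\<B>. x \<in> U \<longrightarrow> nparticles U Z \<noteq> 0)"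
proof (intro iffI ballI impI)
  fix U assume "x \<in> Z" "x \<in> U" then show "nparticles U Z \<noteq> 0"
    by (auto simp: nparticles_eq_0_iff)
next
  assume all: "\<forall>U\<in>\<B>. x \<in> U \<longrightarrow> nparticles U Z \<noteq> 0"
  show "x \<in> Z"
  proof (rule ccontr)
    assume "x \<notin> Z"
    obtain r where r: "r > 0" "cball x r \<subseteq> E"
      using \<open>open E\<close> \<open>x \<in> E\<close> open_contains_cball by blast
    have "finite (Z \<inter> cball x r)" using conf_finite[OF assms(3) compact_cball r(2)] .
    then have "open (ball x r - (Z \<inter> cball x r))"
      by (intro open_Diff open_ball finite_imp_closed)
    moreover have "x \<in> ball x r - (Z \<inter> cball x r)" using r \<open>x \<notin> Z\<close> by auto
    ultimately obtain U where "U \<in> \<B>" "x \<in> U" "U \<subseteq> ball x r - (Z \<inter> cball x r)"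
      using topological_basisE[OF assms(2)] by metis
    then have "nparticles U Z = 0" by (auto simp: nparticles_eq_0_iff)
    with all \<open>U \<in> \<B>\<close> \<open>x \<in> U\<close> show False by auto
  qed
qed

text \<open>Joint measurability of the incidence relation when point and configuration both move:
  over a countable base, each condition separates into one on \<open>f w\<close> and one on the
  count in a fixed set.\<close>

lemma pred_mem_conf:
  fixes f :: "'b \<Rightarrow> 'a::euclidean_space"
  assumes "open E"
    and f [measurable]: "f \<in> borel_measurable M" and f_E: "\<And>w. w \<in> space M \<Longrightarrow> f w \<in> E"
    and g [measurable]: "g \<in> M \<rightarrow>\<^sub>M conf_space E E"
  shows "Measurable.pred M (\<lambda>w. f w \<in> g w)"
proof -
  obtain \<B> :: "'a set set" where \<B>: "countable \<B>" "topological_basis \<B>"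
    using ex_countable_basis by blast
  have gE: "g w \<in> conf E E" if "w \<in> space M" for w
    using measurable_space[OF g that] by simp
  have "Measurable.pred M (\<lambda>w. \<forall>U\<in>\<B>. f w \<in> U \<longrightarrow> nparticles U (g w) \<noteq> 0)"
  proof (rule pred_ball_countable[OF \<B>(1)])
    fix U assume "U \<in> \<B>"
    then have [measurable]: "U \<in> sets borel" using topological_basis_open[OF \<B>(2)] by auto
    have [measurable]: "E \<in> sets borel" using \<open>open E\<close> by auto
    show "Measurable.pred M (\<lambda>w. f w \<in> U \<longrightarrow> nparticles U (g w) \<noteq> 0)"
      using measurable_compose[OF g measurable_nparticles[of U E]] by measurable
  qed
  moreover have "f w \<in> g w \<longleftrightarrow> (\<forall>U\<in>\<B>. f w \<in> U \<longrightarrow> nparticles U (g w) \<noteq> 0)" if "w \<in> space M" for w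
    by (rule mem_conf_iff[OF assms(1) \<B>(2) gE[OF that] f_E[OF that]])
  ultimately show ?thesis
    by (subst measurable_cong) 
qed

section \<open>Tail events and countability of configurations\<close>

lemma outer_algebra_cong:
  assumes "A \<in> sets (outer_algebra E C)" "X \<in> conf E E" "Y \<in> conf E E" "X \<inter> C = Y \<inter> C"
  shows "X \<in> A \<longleftrightarrow> Y \<in> A"
  using assms(1) unfolding outer_algebra_def sets_count_algebra
proof induction
  case (Basic a)
  then obtain B S where a: "a = nparticles B -` S \<inter> conf E E" "B \<subseteq> C" by auto
  have "X \<inter> B = Y \<inter> B" using assms(4) a(2) by auto
  then show ?case using assms(2,3) by (auto simp: a nparticles_def)
qed (use assms(2,3) in auto)

text \<open>Applied with \<open>K\<close> a finite set of removed particles, this keeps reduced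
  configurations inside \<open>W\<close>.\<close>

lemma tail_algebra_cong:
  assumes "W \<in> tail_algebra E" "X \<in> conf E E" "Y \<in> conf E E" "compact K" "K \<subseteq> E" "X - K = Y - K"
  shows "X \<in> W \<longleftrightarrow> Y \<in> W"
proof (rule outer_algebra_cong[OF _ assms(2,3)])
  show "W \<in> sets (outer_algebra E (E - K))" using assms(1,4,5) by (auto simp: tail_algebra_def)
  show "X \<inter> (E - K) = Y \<inter> (E - K)" using assms(2,3,6) conf_subset by blast
qed

text \<open>By Lindelof, countably many balls whose closed versions lie in \<open>E\<close> cover
  \<open>E\<close>, and each contains finitely many particles. Countability is what makes almost
  every tuple avoid the particles.\<close>

lemma countable_conf:
  fixes E :: "'a::euclidean_space set"
  assumes "open E" "X \<in> conf E C"
  shows "countable X"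
proof -
  have "X \<subseteq> E" using conf_subset[OF assms(2)] by auto
  define c where "c x = (SOME r. r > 0 \<and> cball x r \<subseteq> E)" for x
  have c: "c x > 0 \<and> cball x (c x) \<subseteq> E" if "x \<in> E" for x
    unfolding c_def by (rule someI_ex) (use assms(1) that open_contains_cball in blast)
  obtain F where F: "F \<subseteq> (\<lambda>x. ball x (c x)) ` E" "countable F" "\<Union>F = \<Union>((\<lambda>x. ball x (c x)) ` E)"
    using Lindelof[of "(\<lambda>x. ball x (c x)) ` E"] by auto
  have "E \<subseteq> \<Union>F" unfolding F(3) using c by force
  then have "X = (\<Union>U\<in>F. X \<inter> U)" using \<open>X \<subseteq> E\<close> by auto
  moreover have "finite (X \<inter> U)" if U: "U \<in> F" for U
  proof -
    obtain x where x: "x \<in> E" "U = ball x (c x)" using F(1) U by blast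
    have "finite (X \<inter> cball x (c x))" using conf_finite[OF assms(2) compact_cball] c[OF x(1)] by auto
    then show ?thesis by (rule rev_finite_subset) (auto simp: x)
  qed
  ultimately show ?thesis using F(2) by (metis countable_UN countable_finite)
qed

section \<open>Lebesgue measure on tuples\<close>

text \<open>Fubini in a single coordinate: the exceptional set is null once all its sections along
  coordinate \<open>i\<close> are.\<close>

lemma (in product_sigma_finite) AE_PiM_coordinate:
  assumes "finite J" "i \<in> J" and [measurable]: "Measurable.pred (PiM J M) P"
    and ae: "\<And>x. x \<in> space (PiM (J - {i}) M) \<Longrightarrow> AE y in M i. P (x(i := y))"
  shows "AE x in PiM J M. P x"
proof -
  let ?N = "{x\<in>space (PiM J M). \<not> P x}"
  have J: "insert i (J - {i}) = J" using assms by auto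
  have "emeasure (PiM J M) ?N = (\<integral>\<^sup>+x. indicator ?N x \<partial>PiM (insert i (J - {i})) M)"
    unfolding J by simp
  also have "\<dots> = (\<integral>\<^sup>+x. (\<integral>\<^sup>+y. indicator ?N (x(i := y)) \<partial>M i) \<partial>PiM (J - {i}) M)"
  proof (rule product_nn_integral_insert)
    show "indicator ?N \<in> borel_measurable (PiM (insert i (J - {i})) M)"
      unfolding J by measurable
  qed (use assms(1) in auto)
  also have "\<dots> = (\<integral>\<^sup>+x. 0 \<partial>PiM (J - {i}) M)"
  proof (rule nn_integral_cong)
    fix x assume x: "x \<in> space (PiM (J - {i}) M)"
    have "(\<integral>\<^sup>+y. indicator ?N (x(i := y)) \<partial>M i) = (\<integral>\<^sup>+y. 0 \<partial>M i)"
      using ae[OF x] by (intro nn_integral_cong_AE) (auto elim!: eventually_mono)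
    then show "(\<integral>\<^sup>+y. indicator ?N (x(i := y)) \<partial>M i) = 0" by simp
  qed
  finally have "emeasure (PiM J M) ?N = 0" by simp
  moreover have "?N \<in> sets (PiM J M)" by measurable
  ultimately show ?thesis by (intro AE_I[of _ _ ?N]) auto
qed

lemma space_leb_tuples [simp]: "space (leb_tuples l C) = {..<l} \<rightarrow>\<^sub>E C"
  by (simp add: leb_tuples_def space_PiM space_restrict_space)

lemma sigma_finite_restrict_lborel:
  "C \<in> sets borel \<Longrightarrow> sigma_finite_measure (restrict_space lborel C)"
  by (rule sigma_finite_measure_restrict_space) (auto intro: lborel.sigma_finite_measure_axioms)

lemma product_sigma_finite_restrict_lborel:
  "C \<in> sets borel \<Longrightarrow> product_sigma_finite (\<lambda>_. restrict_space lborel C)"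
  unfolding product_sigma_finite_def by (auto intro: sigma_finite_restrict_lborel)

lemma sigma_finite_leb_tuples:
  "C \<in> sets borel \<Longrightarrow> sigma_finite_measure (leb_tuples l C)"
  unfolding leb_tuples_def
  by (rule product_sigma_finite.sigma_finite[OF product_sigma_finite_restrict_lborel]) auto

lemma measurable_leb_tuples_component [measurable]:
  assumes "i < l"
  shows "(\<lambda>p. p i) \<in> borel_measurable (leb_tuples l C)"
proof -
  have "(\<lambda>p. p i) \<in> leb_tuples l C \<rightarrow>\<^sub>M restrict_space lborel C"
    unfolding leb_tuples_def using assms by (intro measurable_component_singleton) auto
  then show ?thesis by (simp add: measurable_restrict_space2_iff)
qed

lemma measurable_leb_tuplesI:
  assumes "\<And>w. w \<in> space M \<Longrightarrow> f w \<in> {..<l} \<rightarrow>\<^sub>E C"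
    and "\<And>i. i < l \<Longrightarrow> (\<lambda>w. f w i) \<in> borel_measurable M"
  shows "f \<in> M \<rightarrow>\<^sub>M leb_tuples l C"
  unfolding leb_tuples_def
proof (rule measurable_PiM_single')
  show "(\<lambda>w. f w i) \<in> M \<rightarrow>\<^sub>M restrict_space lborel C" if "i \<in> {..<l}" for i
    using assms that by (intro measurable_restrict_space2) auto
qed (use assms(1) in \<open>auto simp: space_restrict_space\<close>)

text \<open>Both measures agree on boxes, which determines a product of sigma-finite measures. This
  ties the integrals over tuples in \<open>I\<close> to the Lebesgue measure on tuples in
  \<open>E\<close> that occurs in the Palm formula.\<close>

lemma leb_tuples_restrict:
  fixes C D :: "'a::euclidean_space set"
  assumes "C \<in> sets borel" "D \<in> sets borel" "C \<subseteq> D"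
  shows "leb_tuples l C = restrict_space (leb_tuples l D) ({..<l} \<rightarrow>\<^sub>E C)"
proof -
  let ?R = "restrict_space (leb_tuples l D) ({..<l} \<rightarrow>\<^sub>E C)"
  interpret C: product_sigma_finite "\<lambda>_. restrict_space lborel C"
    by (rule product_sigma_finite_restrict_lborel) fact
  interpret D: product_sigma_finite "\<lambda>_. restrict_space lborel D"
    by (rule product_sigma_finite_restrict_lborel) fact
  have CD: "({..<l} \<rightarrow>\<^sub>E C) \<subseteq> ({..<l} \<rightarrow>\<^sub>E D)" using assms(3) by (auto simp: PiE_def Pi_def)
  have sp: "space ?R = {..<l} \<rightarrow>\<^sub>E C" using CD by (auto simp: space_restrict_space)
  have C_D: "C \<in> sets (restrict_space lborel D)"
    using assms by (subst sets_restrict_space_iff) auto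
  have C_in: "({..<l} \<rightarrow>\<^sub>E C) \<in> sets (leb_tuples l D)"
    unfolding leb_tuples_def by (rule sets_PiM_I_finite) (use C_D in auto)
  have id1: "(\<lambda>p. p) \<in> leb_tuples l C \<rightarrow>\<^sub>M ?R"
    by (rule measurable_restrict_space2) (auto intro!: measurable_leb_tuplesI subsetD[OF CD])
  have id2: "(\<lambda>p. p) \<in> ?R \<rightarrow>\<^sub>M leb_tuples l C"
    by (rule measurable_leb_tuplesI) (auto simp: sp intro!: measurable_restrict_space1)
  have sets: "sets ?R = sets (leb_tuples l C)"
  proof (intro subset_antisym subsetI)
    fix A assume A: "A \<in> sets ?R"
    from measurable_sets[OF id1 A] sets.sets_into_space[OF A] show "A \<in> sets (leb_tuples l C)"
      by (simp add: sp Int_absorb2)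
  next
    fix A assume A: "A \<in> sets (leb_tuples l C)"
    from measurable_sets[OF id2 A] sets.sets_into_space[OF A] show "A \<in> sets ?R"
      by (simp add: sp Int_absorb2)
  qed
  have "?R = PiM {..<l} (\<lambda>_. restrict_space lborel C)"
  proof (rule C.PiM_eqI)
    show "sets ?R = sets (PiM {..<l} (\<lambda>_. restrict_space lborel C))"
      using sets by (simp add: leb_tuples_def)
    fix A :: "nat \<Rightarrow> 'a set" assume A: "\<And>i. i \<in> {..<l} \<Longrightarrow> A i \<in> sets (restrict_space lborel C)"
    have A': "A i \<in> sets borel" "A i \<subseteq> C" "A i \<subseteq> D" if "i < l" for i
      using A[of i] that assms by (auto simp: sets_restrict_space_iff)
    have "Pi\<^sub>E {..<l} A \<subseteq> {..<l} \<rightarrow>\<^sub>E C" using A' by (intro PiE_mono) auto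
    then have "emeasure ?R (Pi\<^sub>E {..<l} A) = emeasure (leb_tuples l D) (Pi\<^sub>E {..<l} A)"
      using C_in CD by (intro emeasure_restrict_space) (auto simp: Int_absorb2)
    also have "\<dots> = (\<Prod>i\<in>{..<l}. emeasure (restrict_space lborel D) (A i))"
      unfolding leb_tuples_def using A' assms
      by (intro D.emeasure_PiM) (auto simp: sets_restrict_space_iff)
    also have "\<dots> = (\<Prod>i\<in>{..<l}. emeasure (restrict_space lborel C) (A i))"
      using A' assms by (intro prod.cong) (auto simp: emeasure_restrict_space)
    finally show "emeasure ?R (Pi\<^sub>E {..<l} A) = (\<Prod>i\<in>{..<l}. emeasure (restrict_space lborel C) (A i))" .
  qed simp
  then show ?thesis by (simp add: leb_tuples_def)
qed

section \<open>Tuples of distinct points\<close>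

lemma conf_tuples_iff:
  "p \<in> {..<l} \<rightarrow>\<^sub>E E \<Longrightarrow>
    p \<in> conf_tuples l (E - Z) \<longleftrightarrow> (\<forall>i<l. p i \<notin> Z) \<and> (\<forall>i<l. \<forall>j<l. i \<noteq> j \<longrightarrow> p i \<noteq> p j)"
  by (auto simp: conf_tuples_def inj_on_def PiE_iff)

lemma pred_conf_tuples:
  fixes E :: "'a::euclidean_space set"
  assumes "open E"
    and f [measurable]: "f \<in> M \<rightarrow>\<^sub>M leb_tuples l E"
    and g [measurable]: "g \<in> M \<rightarrow>\<^sub>M conf_space E E"
  shows "Measurable.pred M (\<lambda>w. f w \<in> conf_tuples l (E - g w))"
proof -
  have f_E: "f w \<in> {..<l} \<rightarrow>\<^sub>E E" if "w \<in> space M" for w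
    using measurable_space[OF f that] by simp
  have comp: "(\<lambda>w. f w i) \<in> borel_measurable M" if "i < l" for i
    using measurable_compose[OF f measurable_leb_tuples_component[OF that]] .
  have 1: "Measurable.pred M (\<lambda>w. f w i \<in> g w)" if "i < l" for i
    by (rule pred_mem_conf[OF assms(1) comp[OF that] _ g]) (use f_E that in auto)
  have 2: "Measurable.pred M (\<lambda>w. f w i = f w j)" if "i < l" "j < l" for i j
    using comp[OF that(1)] comp[OF that(2)] by measurable
  have "Measurable.pred M (\<lambda>w. (\<forall>i<l. f w i \<notin> g w) \<and> (\<forall>i<l. \<forall>j<l. i \<noteq> j \<longrightarrow> f w i \<noteq> f w j))"
    by (intro pred_intros_logic(2,3) pred_intros_countable(1) pred_intros_imp' 1 2)
  also have "Measurable.pred M (\<lambda>w. (\<forall>i<l. f w i \<notin> g w) \<and> (\<forall>i<l. \<forall>j<l. i \<noteq> j \<longrightarrow> f w i \<noteq> f w j)) \<longleftrightarrow> ?thesis"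
    by (intro measurable_cong conf_tuples_iff[symmetric] f_E)
  finally show ?thesis .
qed

lemma empty_in_conf [simp]: "{} \<in> conf E C"
  by (simp add: conf_def)

lemma conf_tuples_in_sets:
  fixes E :: "'a::euclidean_space set"
  assumes "open E" "I \<in> sets borel" "I \<subseteq> E"
  shows "conf_tuples l I \<in> sets (leb_tuples l E)"
proof -
  have [measurable]: "Measurable.pred (leb_tuples l E) (\<lambda>p. p \<in> conf_tuples l (E - {}))"
    by (rule pred_conf_tuples[OF assms(1)]) auto
  have [measurable]: "Measurable.pred (leb_tuples l E) (\<lambda>p. p i \<in> I)" if "i < l" for i
    using assms(2) measurable_leb_tuples_component[OF that] by measurable
  have "conf_tuples l I = {p\<in>space (leb_tuples l E). p \<in> conf_tuples l (E - {}) \<and> (\<forall>i<l. p i \<in> I)}"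
    using assms(3) by (auto simp: conf_tuples_def PiE_iff)
  also have "\<dots> \<in> sets (leb_tuples l E)" by measurable
  finally show ?thesis .
qed

lemma leb_conf_tuples_eq_restrict:
  fixes E :: "'a::euclidean_space set"
  assumes "open E" "I \<in> sets borel" "I \<subseteq> E"
  shows "leb_conf_tuples l I = restrict_space (leb_tuples l E) (conf_tuples l I)"
proof -
  have E: "E \<in> sets borel" using assms by auto
  have "({..<l} \<rightarrow>\<^sub>E I) \<in> sets (leb_tuples l E)"
    unfolding leb_tuples_def using assms
    by (intro sets_PiM_I_finite) (auto simp: sets_restrict_space_iff)
  moreover have "({..<l} \<rightarrow>\<^sub>E I) \<inter> conf_tuples l I = conf_tuples l I"
    by (auto simp: conf_tuples_def)
  ultimately show ?thesis
    unfolding leb_conf_tuples_def leb_tuples_restrict[OF assms(2) E assms(3)]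
    using conf_tuples_in_sets[OF assms]
    by (subst restrict_restrict_space) (metis sets.Int sets.top space_leb_tuples, metis sets.Int sets.top space_leb_tuples, simp)
qed

lemma space_leb_conf_tuples [simp]: "space (leb_conf_tuples l I) = conf_tuples l I"
  by (auto simp: leb_conf_tuples_def space_restrict_space conf_tuples_def)

lemma measurable_leb_conf_tuples_incl:
  fixes E :: "'a::euclidean_space set"
  assumes "open E" "I \<in> sets borel" "I \<subseteq> E"
  shows "(\<lambda>p. p) \<in> leb_conf_tuples l I \<rightarrow>\<^sub>M leb_tuples l E"
  unfolding leb_conf_tuples_eq_restrict[OF assms] by (intro measurable_restrict_space1) auto

lemma sigma_finite_leb_conf_tuples:
  fixes E :: "'a::euclidean_space set"
  assumes "open E" "I \<in> sets borel" "I \<subseteq> E"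
  shows "sigma_finite_measure (leb_conf_tuples l I)"
  unfolding leb_conf_tuples_eq_restrict[OF assms]
  using conf_tuples_in_sets[OF assms] sigma_finite_leb_tuples[of E l] assms(1)
  by (intro sigma_finite_measure_restrict_space) auto

text \<open>Hitting the countable set \<open>Y\<close> and having two equal coordinates are null
  events; each is seen in one coordinate with the others frozen.\<close>

lemma AE_leb_tuples_conf_tuples:
  fixes E :: "'a::euclidean_space set"
  assumes "open E" "countable Y"
  shows "AE q in leb_tuples l E. q \<in> conf_tuples l (E - Y)"
proof -
  have E [measurable]: "E \<in> sets borel" using assms by auto
  interpret product_sigma_finite "\<lambda>_::nat. restrict_space lborel E"
    by (rule product_sigma_finite_restrict_lborel) fact
  have Y [measurable]: "Y \<in> sets borel" using assms(2)
    by (metis countable_imp_null_set_lborel null_setsD2 sets_lborel)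
  have ae_E: "AE y in restrict_space lborel E. y \<notin> N" if "countable N" for N
  proof -
    have "AE y in lborel. y \<notin> N"
      by (rule AE_not_in) (use that in \<open>rule countable_imp_null_set_lborel\<close>)
    then show ?thesis using E by (subst AE_restrict_space_iff) (auto elim!: eventually_mono)
  qed
  have 1: "AE q in leb_tuples l E. q i \<notin> Y" if "i < l" for i
    unfolding leb_tuples_def
  proof (rule AE_PiM_coordinate)
    show "Measurable.pred (PiM {..<l} (\<lambda>_. restrict_space lborel E)) (\<lambda>q. q i \<notin> Y)"
      using measurable_leb_tuples_component[OF that, of E] unfolding leb_tuples_def by measurable
  qed (use that ae_E[OF assms(2)] in auto)
  have 2: "AE q in leb_tuples l E. q i \<noteq> q j" if "i < l" "j < l" "i \<noteq> j" for i j
    unfolding leb_tuples_def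
  proof (rule AE_PiM_coordinate)
    show "Measurable.pred (PiM {..<l} (\<lambda>_. restrict_space lborel E)) (\<lambda>q. q i \<noteq> q j)"
      unfolding leb_tuples_def[symmetric] pred_def
      using measurable_equality_set[OF measurable_leb_tuples_component[OF that(1), of E]
        measurable_leb_tuples_component[OF that(2), of E]] by (intro sets.sets_Collect_neg)
    show "AE y in restrict_space lborel E. (x(i := y)) i \<noteq> (x(i := y)) j" for x
      using ae_E[of "{x j}"] that by auto
  qed (use that in auto)
  have "AE q in leb_tuples l E. (\<forall>i\<in>{..<l}. q i \<notin> Y) \<and> (\<forall>i\<in>{..<l}. \<forall>j\<in>{..<l}. i \<noteq> j \<longrightarrow> q i \<noteq> q j)"
    using 1 2 by (auto simp: AE_ball_countable)
  then show ?thesis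
    using AE_space by eventually_elim (auto simp: conf_tuples_iff)
qed

lemma nparticles_image:
  fixes p :: "nat \<Rightarrow> 'a"
  assumes "inj_on p {..<l}"
  shows "nparticles B (p ` {..<l}) = (\<Sum>i<l. indicator B (p i))"
proof -
  have "nparticles B (p ` {..<l}) = of_nat (card (p ` {i\<in>{..<l}. p i \<in> B}))"
  proof -
    have "finite (p ` {..<l} \<inter> B)" by (rule finite_subset[OF Int_lower1]) (rule finite_imageI, simp)
    moreover have "p ` {..<l} \<inter> B = p ` {i\<in>{..<l}. p i \<in> B}" by auto
    ultimately show ?thesis by (simp add: nparticles_finite)
  qed
  also have "card (p ` {i\<in>{..<l}. p i \<in> B}) = card {i\<in>{..<l}. p i \<in> B}"
    using assms by (intro card_image) (auto simp: inj_on_def)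
  also have "of_nat \<dots> = (\<Sum>i<l. indicator B (p i) :: ennreal)"
    by (simp add: indicator_def sum.If_cases Int_def)
  finally show ?thesis .
qed

lemma measurable_tuple_image:
  fixes E :: "'a::euclidean_space set"
  assumes "open E" "I \<in> sets borel" "I \<subseteq> E"
  shows "(\<lambda>p. p ` {..<l}) \<in> leb_conf_tuples l I \<rightarrow>\<^sub>M conf_space E I"
proof (rule measurable_conf_spaceI)
  fix p assume "p \<in> space (leb_conf_tuples l I)"
  then show "p ` {..<l} \<in> conf E I" using assms(3) by (auto simp: conf_def conf_tuples_def)
next
  fix B :: "'a set" assume [measurable]: "B \<in> sets borel"
  have c: "(\<lambda>p. p i) \<in> borel_measurable (leb_conf_tuples l I)" if "i < l" for i
    using measurable_compose[OF measurable_leb_conf_tuples_incl[OF assms] measurable_leb_tuples_component[OF that]] .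
  have "(\<lambda>p. \<Sum>i<l. indicator B (p i) :: ennreal) \<in> borel_measurable (leb_conf_tuples l I)"
    by (rule borel_measurable_sum) (use c in measurable)
  then show "(\<lambda>p. nparticles B (p ` {..<l})) \<in> borel_measurable (leb_conf_tuples l I)"
    by (subst measurable_cong[OF nparticles_image]) (auto simp: conf_tuples_def)
qed

text \<open>Continuity refers to the product topology on functions on all of \<open>nat\<close>,
  whose Borel sets are those of the infinite product; the tuples sit in it as extensional
  functions.\<close>

lemma continuous_on_imp_measurable_leb_tuples:
  fixes f :: "(nat \<Rightarrow> 'a::euclidean_space) \<Rightarrow> real"
  assumes "continuous_on ({..<l} \<rightarrow>\<^sub>E E) f"
  shows "f \<in> borel_measurable (leb_tuples l E)"
proof -
  have "(\<lambda>p. p) \<in> leb_tuples l E \<rightarrow>\<^sub>M (PiM UNIV (\<lambda>_. borel) :: (nat \<Rightarrow> 'a) measure)"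
  proof (rule measurable_PiM_single')
    fix i :: nat
    show "(\<lambda>p. p i) \<in> leb_tuples l E \<rightarrow>\<^sub>M (borel :: 'a measure)"
    proof (cases "i < l")
      \<comment> \<open>Coordinates from \<open>l\<close> on are constantly
        \<open>undefined\<close>, hence trivially measurable.\<close>
      case False
      then have "(\<lambda>p. p i) \<in> leb_tuples l E \<rightarrow>\<^sub>M (borel :: 'a measure)
          \<longleftrightarrow> (\<lambda>p. undefined :: 'a) \<in> leb_tuples l E \<rightarrow>\<^sub>M borel"
        by (intro measurable_cong) (auto simp: PiE_iff extensional_def)
      then show ?thesis by simp
    qed simp
  qed auto
  then have "(\<lambda>p. p) \<in> leb_tuples l E \<rightarrow>\<^sub>M (borel :: (nat \<Rightarrow> 'a) measure)"
    by (simp add: measurable_cong_sets[OF refl sets_PiM_equal_borel])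
  then have "(\<lambda>p. p) \<in> leb_tuples l E \<rightarrow>\<^sub>M restrict_space borel ({..<l} \<rightarrow>\<^sub>E E)"
    by (intro measurable_restrict_space2) auto
  from measurable_compose[OF this borel_measurable_continuous_on_restrict[OF assms]]
  show ?thesis .
qed

text \<open>The number of orderings of \<open>l\<close> particles; the factor \<open>fact l\<close>
  originates here.\<close>

lemma card_conf_tuples:
  assumes "finite A" "card A = l"
  shows "finite (conf_tuples l A)" "card (conf_tuples l A) = fact l"
proof -
  show "finite (conf_tuples l A)"
    unfolding conf_tuples_def
    by (rule rev_finite_subset[OF finite_PiE[of "{..<l}" "\<lambda>_. A"]]) (use assms(1) in auto)
  have "card (conf_tuples l A) = prod ((-) l) {0..<l}"
    using card_inj_on_subset_funcset[of "{..<l}" A "{..<l}"] assms by (simp add: conf_tuples_def)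
  also have "\<dots> = fact l"
    unfolding fact_prod_rev atLeast0LessThan by simp
  finally show "card (conf_tuples l A) = fact l" .
qed

lemma conf_tuples_image:
  assumes "p \<in> conf_tuples l A" "finite A" "card A = l"
  shows "p ` {..<l} = A"
  using assms by (intro card_subset_eq) (auto simp: conf_tuples_def card_image)

section \<open>Reduced Palm measures\<close>

text \<open>The condition says that the kernel integral of the indicator of the exceptional set
  vanishes, and kernel integrals are measurable in the parameter. Such conditions occur below inside
  further almost-everywhere quantifiers, whose exchange requires their measurability.\<close>

lemma pred_AE_kernel:
  assumes "Measurable.pred (M \<Otimes>\<^sub>M N) (\<lambda>w. R (fst w) (snd w))"
    and K: "K \<in> M \<rightarrow>\<^sub>M subprob_algebra N"
  shows "Measurable.pred M (\<lambda>x. AE y in K x. R x y)"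
proof -
  have [measurable]: "Measurable.pred (M \<Otimes>\<^sub>M N) (\<lambda>(x, y). R x y)"
    using assms(1) by (simp add: case_prod_beta)
  have sets_K: "sets (K x) = sets N" if "x \<in> space M" for x
    using measurable_space[OF K that] by (simp add: space_subprob_algebra)
  have "(\<lambda>x. \<integral>\<^sup>+y. (if R x y then 0 else 1) \<partial>K x) \<in> borel_measurable M"
    by (rule nn_integral_measurable_subprob_algebra2[OF _ K]) measurable
  then have "Measurable.pred M (\<lambda>x. (\<integral>\<^sup>+y. (if R x y then 0 else 1) \<partial>K x) = 0)" by measurable
  also have "?this \<longleftrightarrow> ?thesis"
  proof (rule measurable_cong)
    fix x assume x: "x \<in> space M"
    have [measurable]: "Measurable.pred (K x) (R x)"
      using measurable_compose[OF measurable_Pair1'[OF x] assms(1)]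
      by (simp add: measurable_cong_sets[OF sets_K[OF x] refl])
    have "(\<lambda>y. if R x y then 0 else 1 :: ennreal) \<in> borel_measurable (K x)" by measurable
    then show "(\<integral>\<^sup>+y. (if R x y then 0 else 1) \<partial>K x) = 0 \<longleftrightarrow> (AE y in K x. R x y)"
      by (subst nn_integral_0_iff_AE) (auto intro!: arg_cong[where f="\<lambda>P. eventually P _"] simp: fun_eq_iff)
  qed
  finally show ?thesis .
qed

text \<open>The same argument with a fixed sigma-finite measure in place of a kernel.\<close>

lemma (in sigma_finite_measure) pred_AE:
  assumes "Measurable.pred (N \<Otimes>\<^sub>M M) (\<lambda>w. R (fst w) (snd w))"
  shows "Measurable.pred N (\<lambda>x. AE y in M. R x y)"
proof -
  have [measurable]: "Measurable.pred (N \<Otimes>\<^sub>M M) (\<lambda>(x, y). R x y)"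
    using assms(1) by (simp add: case_prod_beta)
  have "(\<lambda>x. \<integral>\<^sup>+y. (if R x y then 0 else 1) \<partial>M) \<in> borel_measurable N"
    by (rule borel_measurable_nn_integral) measurable
  then have "Measurable.pred N (\<lambda>x. (\<integral>\<^sup>+y. (if R x y then 0 else 1) \<partial>M) = 0)" by measurable
  also have "?this \<longleftrightarrow> ?thesis"
  proof (rule measurable_cong)
    fix x assume x: "x \<in> space N"
    have [measurable]: "Measurable.pred M (R x)"
      using measurable_compose[OF measurable_Pair1'[OF x] assms(1)] by simp
    have "(\<lambda>y. if R x y then 0 else 1 :: ennreal) \<in> borel_measurable M" by measurable
    then show "(\<integral>\<^sup>+y. (if R x y then 0 else 1) \<partial>M) = 0 \<longleftrightarrow> (AE y in M. R x y)"
      by (subst nn_integral_0_iff_AE) (auto intro!: arg_cong[where f="\<lambda>P. eventually P _"] simp: fun_eq_iff)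
  qed
  finally show ?thesis .
qed

text \<open>\<open>RN_version\<close> passes through \<open>enn2real\<close>; nothing is lost,
  because the derivative of a probability measure is finite almost everywhere.\<close>

lemma RN_version_density:
  assumes "prob_space M" "prob_space N" "sets N = sets M" "f \<in> borel_measurable M" "RN_version M N f"
  shows "density M (\<lambda>x. ennreal (f x)) = N" "AE x in M. 0 \<le> f x"
proof -
  interpret M: prob_space M by fact
  interpret N: prob_space N by fact
  have ac: "absolutely_continuous M N" and f: "AE x in M. f x = enn2real (RN_deriv M N x)"
    using assms(5) by (auto simp: RN_version_def)
  from f show "AE x in M. 0 \<le> f x" by eventually_elim simp
  have "AE x in M. RN_deriv M N x \<noteq> \<infinity>"
    using M.RN_deriv_finite[OF N.sigma_finite_measure_axioms ac assms(3)] .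
  with f have "AE x in M. ennreal (f x) = RN_deriv M N x"
    by eventually_elim (simp add: less_top)
  then have "density M (\<lambda>x. ennreal (f x)) = density M (RN_deriv M N)"
    using assms(4) by (intro density_cong) auto
  also have "\<dots> = N" by (rule M.density_RN_deriv[OF ac assms(3)])
  finally show "density M (\<lambda>x. ennreal (f x)) = N" .
qed

locale palm_process =
  fixes E :: "'a::euclidean_space set" and P :: "'a set measure" and l :: nat
    and \<rho> :: "(nat \<Rightarrow> 'a) \<Rightarrow> real" and Q :: "(nat \<Rightarrow> 'a) \<Rightarrow> 'a set measure"
  assumes open_E: "open E"
    and point_process: "point_process E P"
    and \<rho>_measurable [measurable]: "\<rho> \<in> borel_measurable (leb_tuples l E)"
    and reduced_palm: "reduced_palm E P l \<rho> Q"
begin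

abbreviation L :: "(nat \<Rightarrow> 'a) measure" where "L \<equiv> leb_tuples l E"

abbreviation N :: "'a set measure" where "N \<equiv> conf_space E E"

lemma E_borel [measurable]: "E \<in> sets borel"
  using open_E by auto

lemma sets_P: "sets P = sets N" and prob_space_P: "prob_space P"
  using point_process by (auto simp: point_process_def)

lemma space_P: "space P = conf E E"
  using sets_eq_imp_space_eq[OF sets_P] by simp

sublocale L: sigma_finite_measure L
  by (rule sigma_finite_leb_tuples) (rule E_borel)

sublocale LL: pair_sigma_finite L L ..

lemma Q_measurable [measurable]: "Q \<in> L \<rightarrow>\<^sub>M subprob_algebra N"
  using reduced_palm by (auto simp: reduced_palm_def intro: measurable_prob_algebraD)

lemma prob_space_Q: "p \<in> space L \<Longrightarrow> prob_space (Q p)"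
  and sets_Q: "p \<in> space L \<Longrightarrow> sets (Q p) = sets N"
proof -
  assume p: "p \<in> space L"
  have "Q \<in> L \<rightarrow>\<^sub>M prob_algebra N" using reduced_palm by (simp add: reduced_palm_def)
  from measurable_space[OF this p] show "prob_space (Q p)" "sets (Q p) = sets N"
    by (auto simp: space_prob_algebra)
qed

lemma palm_formula:
  "f \<in> borel_measurable (L \<Otimes>\<^sub>M N) \<Longrightarrow>
    (\<integral>\<^sup>+X. (\<integral>\<^sup>+x. f (x, X - x ` {..<l}) \<partial>count_space (conf_tuples l X)) \<partial>P) =
    (\<integral>\<^sup>+q. (\<integral>\<^sup>+X. f (q, X) \<partial>Q q) * ennreal (\<rho> q) \<partial>L)"
  using reduced_palm by (simp add: reduced_palm_def)

(* The sum over the tuples of Y need not be measurable in Y, so the nn_integral over P is only a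
   lower integral.  Hence the transfer is possible from P to the Palm measures, but not back. *)
lemma palm_AE:
  assumes R: "Measurable.pred (L \<Otimes>\<^sub>M N) (\<lambda>w. R (fst w) (snd w))"
    and ae: "AE Y in P. \<forall>p\<in>conf_tuples l Y. R p (Y - p ` {..<l})"
  shows "AE p in L. 0 < \<rho> p \<longrightarrow> (AE Z in Q p. R p Z)"
proof -
  define f :: "(nat \<Rightarrow> 'a) \<times> 'a set \<Rightarrow> ennreal" where "f w = (if R (fst w) (snd w) then 0 else 1)" for w
  have f: "f \<in> borel_measurable (L \<Otimes>\<^sub>M N)" unfolding f_def using R by measurable
  have "AE Y in P. (\<integral>\<^sup>+x. f (x, Y - x ` {..<l}) \<partial>count_space (conf_tuples l Y)) = 0"
    using ae
  proof eventually_elim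
    case (elim Y)
    then have "(\<integral>\<^sup>+x. f (x, Y - x ` {..<l}) \<partial>count_space (conf_tuples l Y)) =
        (\<integral>\<^sup>+x. 0 \<partial>count_space (conf_tuples l Y))"
      by (intro nn_integral_cong) (auto simp: f_def)
    then show ?case by simp
  qed
  then have "(\<integral>\<^sup>+X. (\<integral>\<^sup>+x. f (x, X - x ` {..<l}) \<partial>count_space (conf_tuples l X)) \<partial>P) = (\<integral>\<^sup>+X. 0 \<partial>P)"
    by (rule nn_integral_cong_AE)
  then have "(\<integral>\<^sup>+q. (\<integral>\<^sup>+X. f (q, X) \<partial>Q q) * ennreal (\<rho> q) \<partial>L) = 0"
    using palm_formula[OF f] by simp
  moreover have "(\<lambda>q. \<integral>\<^sup>+X. f (q, X) \<partial>Q q) \<in> borel_measurable L"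
    by (rule nn_integral_measurable_subprob_algebra2[OF _ Q_measurable]) (use f in simp)
  ultimately have "AE q in L. (\<integral>\<^sup>+X. f (q, X) \<partial>Q q) * ennreal (\<rho> q) = 0"
    by (subst (asm) nn_integral_0_iff_AE) auto
  then show ?thesis
    using AE_space
  proof eventually_elim
    case (elim q)
    show ?case
    proof
      assume "0 < \<rho> q"
      then have 0: "(\<integral>\<^sup>+X. f (q, X) \<partial>Q q) = 0" using elim(1) by auto
      have "(\<lambda>X. f (q, X)) \<in> borel_measurable (Q q)"
        using measurable_compose[OF measurable_Pair1'[OF elim(2)] f]
        by (simp add: measurable_cong_sets[OF sets_Q[OF elim(2)] refl])
      then have "AE X in Q q. f (q, X) = 0" using 0 by (subst (asm) nn_integral_0_iff_AE) auto
      then show "AE X in Q q. R q X" by eventually_elim (auto simp: f_def split: if_splits)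
    qed
  qed
qed

end

section \<open>Densities between Palm measures of the same order\<close>

locale quasi_symmetric_process = palm_process +
  fixes W :: "'a::euclidean_space set set"
    and \<Psi> :: "(nat \<Rightarrow> 'a) \<Rightarrow> (nat \<Rightarrow> 'a) \<Rightarrow> 'a set \<Rightarrow> real"
  assumes W_borel [measurable]: "W \<in> sets (conf_space E E)"
    and W_tail: "W \<in> tail_algebra E"
    and W_full: "emeasure P W = 1"
    and \<Psi>_measurable: "(\<lambda>(p, q, X). \<Psi> p q X) \<in> borel_measurable
        (restrict_space (leb_tuples l E \<Otimes>\<^sub>M leb_tuples l E \<Otimes>\<^sub>M conf_space E E)
          {(p, q, X). X \<in> W \<and> p \<in> conf_tuples l (E - X) \<and> q \<in> conf_tuples l (E - X)})"
    and \<Psi>_cocycle: "\<And>X p q r. X \<in> W \<Longrightarrow> p \<in> conf_tuples l (E - X) \<Longrightarrow>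
      q \<in> conf_tuples l (E - X) \<Longrightarrow> r \<in> conf_tuples l (E - X) \<Longrightarrow>
      \<Psi> p q X = \<Psi> p r X * \<Psi> r q X"
    and palm_derivative: "palm_derivative E P l \<rho> Q \<Psi>"
begin

text \<open>The domain of \<Psi>, split by argument: \<open>\<Psi> p q Z\<close> is meaningful when
  \<open>adm p Z\<close> and \<open>adm q Z\<close> both hold.\<close>

definition adm :: "(nat \<Rightarrow> 'a) \<Rightarrow> 'a set \<Rightarrow> bool" where
  "adm p Z \<longleftrightarrow> Z \<in> W \<and> p \<in> conf_tuples l (E - Z)"

(* Psi is only measurable on its domain; extending it by 0 makes it jointly measurable. *)
definition \<Phi> :: "(nat \<Rightarrow> 'a) \<Rightarrow> (nat \<Rightarrow> 'a) \<Rightarrow> 'a set \<Rightarrow> real" where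
  "\<Phi> p q Z = (if adm p Z \<and> adm q Z then \<Psi> p q Z else 0)"

lemma pred_adm:
  assumes "f \<in> M \<rightarrow>\<^sub>M L" and g [measurable]: "g \<in> M \<rightarrow>\<^sub>M N"
  shows "Measurable.pred M (\<lambda>w. adm (f w) (g w))"
proof -
  have [measurable]: "Measurable.pred M (\<lambda>w. f w \<in> conf_tuples l (E - g w))"
    using open_E assms by (rule pred_conf_tuples)
  show ?thesis unfolding adm_def by measurable
qed

text \<open>Stated for arbitrary measurable arguments, since below different variables are frozen
  and the factors of the product spaces come in different orders.\<close>

lemma measurable_\<Phi>:
  assumes "f \<in> M \<rightarrow>\<^sub>M L" "g \<in> M \<rightarrow>\<^sub>M L" "h \<in> M \<rightarrow>\<^sub>M N"
  shows "(\<lambda>w. \<Phi> (f w) (g w) (h w)) \<in> borel_measurable M"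
proof -
  let ?M = "L \<Otimes>\<^sub>M L \<Otimes>\<^sub>M N"
  let ?D = "{(p, q, X). X \<in> W \<and> p \<in> conf_tuples l (E - X) \<and> q \<in> conf_tuples l (E - X)}"
  have a: "Measurable.pred ?M (\<lambda>w. adm (fst w) (snd (snd w)))"
    "Measurable.pred ?M (\<lambda>w. adm (fst (snd w)) (snd (snd w)))"
    by (intro pred_adm; measurable)+
  have "?D \<inter> space ?M = {w\<in>space ?M. adm (fst w) (snd (snd w)) \<and> adm (fst (snd w)) (snd (snd w))}"
    by (auto simp: adm_def)
  also have "\<dots> \<in> sets ?M" using a by measurable
  finally have "(\<lambda>w. if w \<in> ?D then (\<lambda>(p, q, X). \<Psi> p q X) w else 0) \<in> borel_measurable ?M"
    using \<Psi>_measurable by (subst (asm) measurable_restrict_space_iff[where c=0]) auto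
  also have "(\<lambda>w. if w \<in> ?D then (\<lambda>(p, q, X). \<Psi> p q X) w else 0) = (\<lambda>(p, q, X). \<Phi> p q X)"
    by (auto simp: \<Phi>_def adm_def fun_eq_iff)
  finally have "(\<lambda>(p, q, X). \<Phi> p q X) \<in> borel_measurable ?M" .
  from measurable_compose[OF measurable_Pair[OF assms(1) measurable_Pair[OF assms(2,3)]] this]
  show ?thesis by simp
qed

text \<open>Removing finitely many particles changes \<open>Y\<close> only on a compact subset of
  \<open>E\<close>, so the tail event \<open>W\<close> is not left; the removed points are then free
  to serve as arguments of \<Psi>.\<close>

lemma adm_remove:
  assumes "Y \<in> W" "p \<in> conf_tuples l Y"
  shows "adm p (Y - p ` {..<l})"
proof -
  have Y: "Y \<in> conf E E" using sets.sets_into_space[OF W_borel] assms(1) by auto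
  then have "p ` {..<l} \<subseteq> E" using assms(2) conf_subset[OF Y] by (auto simp: conf_tuples_def)
  moreover have "Y - p ` {..<l} \<in> conf E E" using conf_mono[OF _ Y, of "Y - p ` {..<l}"] conf_subset[OF Y] by auto
  ultimately have "Y - p ` {..<l} \<in> W"
    using tail_algebra_cong[OF W_tail Y _ finite_imp_compact, of "Y - p ` {..<l}" "p ` {..<l}"] assms(1) by auto
  then show ?thesis
    using assms(2) conf_subset[OF Y] by (auto simp: adm_def conf_tuples_def)
qed

(* The hypothesis identifies D p q with Psi p q only P^p-almost everywhere.  Since it also holds with
   p and q exchanged, P^q is absolutely continuous with respect to P^p for almost all pairs, so the
   identification holds P^q-almost everywhere.  Exchanging the null sets in p and q requires that
   P^p = D p q P^q is a measurable condition on (p, q), whence the countable generator. *)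
lemma palm_density:
  "AE q in L. 0 < \<rho> q \<longrightarrow> (AE p in L. 0 < \<rho> p \<longrightarrow>
    Q p = density (Q q) (\<lambda>Z. ennreal (\<Phi> p q Z)) \<and>
    (AE Z in Q q. adm p Z \<and> adm q Z \<and> 0 \<le> \<Phi> p q Z))"
proof -
  obtain D :: "(nat \<Rightarrow> 'a) \<Rightarrow> (nat \<Rightarrow> 'a) \<Rightarrow> 'a set \<Rightarrow> real" where
    D: "(\<lambda>(p, q, Z). D p q Z) \<in> borel_measurable (L \<Otimes>\<^sub>M L \<Otimes>\<^sub>M N)" and
    ae_D: "AE Y in P. \<forall>p\<in>conf_tuples l Y. AE q in L. q \<in> conf_tuples l (E - Y) \<longrightarrow> 0 < \<rho> q \<longrightarrow>
      RN_version (Q q) (Q p) (D p q) \<and> D p q (Y - p ` {..<l}) = \<Psi> p q (Y - p ` {..<l})"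
    using palm_derivative unfolding palm_derivative_def by blast
  have mD: "(\<lambda>w. D (f w) (g w) (h w)) \<in> borel_measurable M"
    if "f \<in> M \<rightarrow>\<^sub>M L" "g \<in> M \<rightarrow>\<^sub>M L" "h \<in> M \<rightarrow>\<^sub>M N" for f g h and M :: "'z measure"
    using measurable_compose[OF measurable_Pair[OF that(1) measurable_Pair[OF that(2,3)]] D] by simp
  obtain \<G> where \<G>: "countable \<G>" "\<G> \<subseteq> Pow (conf E E)" "Int_stable \<G>" "conf E E \<in> \<G>"
    "sets N = sigma_sets (conf E E) \<G>"
    using conf_space_countably_generated[OF open_E E_borel] by blast

  \<comment> \<open>\<open>S1\<close> identifies \<open>D\<close> with \<Phi> at a point;
    \<open>S2\<close> says, tested on the generator, that \<open>D p q\<close> is a nonnegative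
    density of \<open>Q p\<close> with respect to \<open>Q q\<close>. Both are void unless
    \<open>0 < \<rho> q\<close>.\<close>
  define S1 where "S1 p q Z \<longleftrightarrow> (0 < \<rho> q \<longrightarrow> adm p Z \<and> adm q Z \<and> D p q Z = \<Phi> p q Z)" for p q Z
  define S2 where "S2 p q \<longleftrightarrow> (0 < \<rho> q \<longrightarrow>
    (\<forall>G\<in>\<G>. emeasure (Q p) G = (\<integral>\<^sup>+Z. ennreal (D p q Z) * indicator G Z \<partial>Q q)) \<and>
    (AE Z in Q q. 0 \<le> D p q Z))" for p q

  have mS1: "Measurable.pred M (\<lambda>w. S1 (f w) (g w) (h w))"
    if [measurable]: "f \<in> M \<rightarrow>\<^sub>M L" "g \<in> M \<rightarrow>\<^sub>M L" "h \<in> M \<rightarrow>\<^sub>M N" for f g h and M :: "'z measure"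
  proof -
    note [measurable] = mD[OF that] measurable_\<Phi>[OF that] pred_adm[OF that(1,3)] pred_adm[OF that(2,3)]
      measurable_compose[OF that(2) \<rho>_measurable]
    show ?thesis unfolding S1_def by measurable
  qed
  have mS2: "Measurable.pred (L \<Otimes>\<^sub>M L) (\<lambda>w. S2 (fst w) (snd w))"
  proof -
    have k: "(\<lambda>w. Q (snd w)) \<in> L \<Otimes>\<^sub>M L \<rightarrow>\<^sub>M subprob_algebra N" by measurable
    have D': "(\<lambda>w. D (fst (fst w)) (snd (fst w)) (snd w)) \<in> borel_measurable ((L \<Otimes>\<^sub>M L) \<Otimes>\<^sub>M N)"
      by (rule mD) measurable
    have 1: "Measurable.pred (L \<Otimes>\<^sub>M L) (\<lambda>w. \<forall>G\<in>\<G>. emeasure (Q (fst w)) G =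
        (\<integral>\<^sup>+Z. ennreal (D (fst w) (snd w) Z) * indicator G Z \<partial>Q (snd w)))"
    proof (rule pred_ball_countable[OF \<G>(1)])
      fix G assume "G \<in> \<G>"
      then have G [measurable]: "G \<in> sets N" using \<G>(5) by auto
      have "(\<lambda>w. \<integral>\<^sup>+Z. ennreal (D (fst w) (snd w) Z) * indicator G Z \<partial>Q (snd w)) \<in> borel_measurable (L \<Otimes>\<^sub>M L)"
        by (rule nn_integral_measurable_subprob_algebra2[OF _ k]) (use D' in \<open>unfold case_prod_beta, measurable\<close>)
      moreover have "(\<lambda>w. emeasure (Q (fst w)) G) \<in> borel_measurable (L \<Otimes>\<^sub>M L)" by measurable
      ultimately show "Measurable.pred (L \<Otimes>\<^sub>M L) (\<lambda>w. emeasure (Q (fst w)) G =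
        (\<integral>\<^sup>+Z. ennreal (D (fst w) (snd w) Z) * indicator G Z \<partial>Q (snd w)))"
        unfolding pred_def by (rule borel_measurable_eq[rotated])
    qed
    have "Measurable.pred ((L \<Otimes>\<^sub>M L) \<Otimes>\<^sub>M N) (\<lambda>w. 0 \<le> D (fst (fst w)) (snd (fst w)) (snd w))"
      using D' by measurable
    then have 2: "Measurable.pred (L \<Otimes>\<^sub>M L) (\<lambda>w. AE Z in Q (snd w). 0 \<le> D (fst w) (snd w) Z)"
      by (rule pred_AE_kernel[OF _ k])
    have 3: "Measurable.pred (L \<Otimes>\<^sub>M L) (\<lambda>w. 0 < \<rho> (snd w))" by measurable
    show ?thesis
      unfolding S2_def by (intro pred_intros_logic(3,4) 1 2 3)
  qed

  have "AE Y in P. Y \<in> W"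
  proof -
    interpret P: prob_space P by (rule prob_space_P)
    show ?thesis
      by (rule P.AE_prob_1) (simp add: W_full measure_def)
  qed
  then have ae: "AE Y in P. \<forall>p\<in>conf_tuples l Y. adm p (Y - p ` {..<l}) \<and>
      (AE q in L. S1 p q (Y - p ` {..<l})) \<and> (AE q in L. S2 p q)"
    using ae_D AE_space
  proof eventually_elim
    case (elim Y)
    then have Y: "Y \<in> conf E E" by (simp add: space_P)
    show ?case
    proof
      fix p assume p: "p \<in> conf_tuples l Y"
      let ?Z = "Y - p ` {..<l}"
      have adm: "adm p ?Z" using adm_remove[OF elim(1) p] .
      have pL: "p \<in> space L" using p conf_subset[OF Y] by (auto simp: conf_tuples_def)
      \<comment> \<open>As \<open>Y\<close> is countable, almost every \<open>q\<close> meets the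
        proviso of the hypothesis; such \<open>q\<close> also avoids the smaller configuration
        \<open>?Z\<close>.\<close>
      have "AE q in L. q \<in> conf_tuples l (E - Y)"
        by (rule AE_leb_tuples_conf_tuples[OF open_E countable_conf[OF open_E Y]])
      moreover have "AE q in L. q \<in> conf_tuples l (E - Y) \<longrightarrow> 0 < \<rho> q \<longrightarrow>
          RN_version (Q q) (Q p) (D p q) \<and> D p q ?Z = \<Psi> p q ?Z"
        using elim(2) p by blast
      ultimately have "AE q in L. S1 p q ?Z \<and> S2 p q"
        using AE_space
      proof eventually_elim
        case (elim q)
        have "adm q ?Z" using elim(1) adm by (auto simp: adm_def conf_tuples_def)
        then have "S1 p q ?Z" using elim adm by (auto simp: S1_def \<Phi>_def)
        moreover have "S2 p q"
          unfolding S2_def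
        proof (intro impI conjI ballI)
          assume "0 < \<rho> q"
          then have RN: "RN_version (Q q) (Q p) (D p q)" using elim by auto
          have m: "D p q \<in> borel_measurable (Q q)"
            using mD[of "\<lambda>_. p" N "\<lambda>_. q" "\<lambda>Z. Z"] pL elim(3)
            by (simp add: measurable_cong_sets[OF sets_Q[OF elim(3)] refl])
          note d = RN_version_density[OF prob_space_Q[OF elim(3)] prob_space_Q[OF pL] _ m RN]
          then show "AE Z in Q q. 0 \<le> D p q Z" by (simp add: sets_Q[OF elim(3)] sets_Q[OF pL])
          fix G assume "G \<in> \<G>"
          then have "G \<in> sets (Q q)" using \<G>(5) sets_Q[OF elim(3)] by auto
          moreover have "Q p = density (Q q) (\<lambda>Z. ennreal (D p q Z))"
            using d(1) by (simp add: sets_Q[OF elim(3)] sets_Q[OF pL])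
          ultimately show "emeasure (Q p) G = (\<integral>\<^sup>+Z. ennreal (D p q Z) * indicator G Z \<partial>Q q)"
            using m by (simp add: emeasure_density)
        qed
        ultimately show ?case by simp
      qed
      then show "adm p ?Z \<and> (AE q in L. S1 p q ?Z) \<and> (AE q in L. S2 p q)"
        using adm by auto
    qed
  qed

  have 1: "AE p in L. 0 < \<rho> p \<longrightarrow> (AE Z in Q p. AE q in L. S1 p q Z)"
  proof (rule palm_AE)
    show "Measurable.pred (L \<Otimes>\<^sub>M N) (\<lambda>w. AE q in L. S1 (fst w) q (snd w))"
      by (rule L.pred_AE, rule mS1) measurable
  qed (use ae in \<open>auto elim!: eventually_mono\<close>)
  \<comment> \<open>\<open>S2\<close> does not involve \<open>Z\<close>, yet it too passes through
    the Palm formula: it is known for the tuples of P-almost every \<open>Y\<close>, and this step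
    turns that into almost every \<open>p\<close> with \<open>0 < \<rho> p\<close>.\<close>
  have 2: "AE p in L. 0 < \<rho> p \<longrightarrow> (AE Z in Q p. AE q in L. S2 p q)"
  proof (rule palm_AE)
    have "Measurable.pred L (\<lambda>p. AE q in L. S2 p q)"
      using mS2 by (rule L.pred_AE)
    then show "Measurable.pred (L \<Otimes>\<^sub>M N) (\<lambda>w. AE q in L. S2 (fst w) q)"
      by (rule measurable_compose[OF measurable_fst])
  qed (use ae in \<open>auto elim!: eventually_mono\<close>)

  \<comment> \<open>At this stage \<open>S1\<close> is available under \<open>Q p\<close>, not under
    \<open>Q q\<close>. The guard \<open>0 < \<rho> p\<close> is there because the Palm formula sees
    only such tuples.\<close>
  define T where "T p q \<longleftrightarrow> (0 < \<rho> p \<longrightarrow> S2 p q \<and> (AE Z in Q p. S1 p q Z))" for p q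
  have mT: "Measurable.pred (L \<Otimes>\<^sub>M L) (\<lambda>w. T (fst w) (snd w))"
  proof -
    have k: "(\<lambda>w. Q (fst w)) \<in> L \<Otimes>\<^sub>M L \<rightarrow>\<^sub>M subprob_algebra N" by measurable
    have 1: "Measurable.pred (L \<Otimes>\<^sub>M L) (\<lambda>w. AE Z in Q (fst w). S1 (fst w) (snd w) Z)"
      by (rule pred_AE_kernel[OF _ k], rule mS1) measurable
    have 3: "Measurable.pred (L \<Otimes>\<^sub>M L) (\<lambda>w. 0 < \<rho> (fst w))" by measurable
    show ?thesis
      unfolding T_def by (intro pred_intros_logic(3,4) 1 mS2 3)
  qed
  have T: "AE p in L. AE q in L. T p q"
    using 1 2 AE_space
  proof eventually_elim
    case (elim p)
    show ?case
    proof (cases "0 < \<rho> p")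
      case True
      interpret Qp: prob_space "Q p" by (rule prob_space_Q[OF elim(3)])
      interpret QL: pair_sigma_finite "Q p" L ..
      have "AE q in L. S2 p q" using elim(2) True Qp.AE_const by simp
      moreover have "AE q in L. AE Z in Q p. S1 p q Z"
      proof -
        have "Measurable.pred (N \<Otimes>\<^sub>M L) (\<lambda>w. S1 p (snd w) (fst w))"
          by (rule mS1) (use elim(3) in measurable)
        then have "Measurable.pred (Q p \<Otimes>\<^sub>M L) (\<lambda>w. S1 p (snd w) (fst w))"
          by (simp add: measurable_cong_sets[OF sets_pair_measure_cong[OF sets_Q[OF elim(3)] refl] refl])
        then show ?thesis
          using QL.AE_commute[of "\<lambda>Z q. S1 p q Z"] elim(1) True by (simp add: pred_def)
      qed
      ultimately show ?thesis unfolding T_def by auto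
    qed (simp add: T_def)
  qed
  \<comment> \<open>After the exchange, almost every fixed \<open>q\<close> has both
    \<open>T p q\<close> and \<open>T q p\<close> for almost every \<open>p\<close>.\<close>
  have T': "AE q in L. AE p in L. T p q"
    using T LL.AE_commute[of T] mT by (simp add: pred_def)

  from T T' show ?thesis
    using AE_space
  proof eventually_elim
    case (elim q)
    note qL = elim(3)
    show ?case
    proof
      assume \<rho>q: "0 < \<rho> q"
      from elim(1,2) show "AE p in L. 0 < \<rho> p \<longrightarrow> Q p = density (Q q) (\<lambda>Z. ennreal (\<Phi> p q Z)) \<and>
          (AE Z in Q q. adm p Z \<and> adm q Z \<and> 0 \<le> \<Phi> p q Z)"
        using AE_space
      proof eventually_elim
        case (elim p)
        note pL = elim(3)
        have eq: "Q x = density (Q y) (\<lambda>Z. ennreal (D x y Z))"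
          if "S2 x y" "0 < \<rho> y" and x: "x \<in> space L" and y: "y \<in> space L" for x y
        proof (rule measure_eqI_generator_eq[OF \<G>(3,2), of _ _ "\<lambda>_. conf E E"])
          have m: "D x y \<in> borel_measurable (Q y)"
            using mD[of "\<lambda>_. x" N "\<lambda>_. y" "\<lambda>Z. Z"] x y
            by (simp add: measurable_cong_sets[OF sets_Q[OF y] refl])
          fix G assume "G \<in> \<G>"
          moreover from this have "G \<in> sets (Q y)" using \<G>(5) sets_Q[OF y] by auto
          ultimately show "emeasure (Q x) G = emeasure (density (Q y) (\<lambda>Z. ennreal (D x y Z))) G"
            using that(1,2) m by (simp add: S2_def emeasure_density)
        next
          interpret Qx: prob_space "Q x" by (rule prob_space_Q[OF x])
          show "emeasure (Q x) (conf E E) \<noteq> \<infinity>" by simp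
        qed (use \<G> sets_Q[OF x] sets_Q[OF y] in auto)
        show ?case
        proof
          assume \<rho>p: "0 < \<rho> p"
          have T: "S2 p q" "S2 q p" "AE Z in Q p. S1 p q Z"
            using elim \<rho>p \<rho>q by (auto simp: T_def)
          have m: "D x y \<in> borel_measurable (Q z)" "\<Phi> x y \<in> borel_measurable (Q z)"
            if "x \<in> space L" "y \<in> space L" "z \<in> space L" for x y z
            using mD[of "\<lambda>_. x" N "\<lambda>_. y" "\<lambda>Z. Z"] measurable_\<Phi>[of "\<lambda>_. x" N "\<lambda>_. y" "\<lambda>Z. Z"] that
            by (simp_all add: measurable_cong_sets[OF sets_Q[OF that(3)] refl])
          \<comment> \<open>By \<open>S2 q p\<close> the measure \<open>Q q\<close> has a density
            with respect to \<open>Q p\<close>, so the identification known under \<open>Q p\<close>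
            also holds under \<open>Q q\<close>.\<close>
          have "AE Z in density (Q p) (\<lambda>Z. ennreal (D q p Z)). S1 p q Z"
            using T(3) m(1)[OF qL pL pL] by (subst AE_density) (auto elim!: eventually_mono)
          then have S1: "AE Z in Q q. S1 p q Z"
            by (subst eq[OF T(2) \<rho>p qL pL])
          have "AE Z in Q q. 0 \<le> D p q Z" using T(1) \<rho>q by (simp add: S2_def)
          with S1 have ae: "AE Z in Q q. adm p Z \<and> adm q Z \<and> 0 \<le> \<Phi> p q Z \<and> D p q Z = \<Phi> p q Z"
            by eventually_elim (use \<rho>q in \<open>auto simp: S1_def\<close>)
          from ae have D_\<Phi>: "AE Z in Q q. ennreal (D p q Z) = ennreal (\<Phi> p q Z)"
            by eventually_elim simp
          have "Q p = density (Q q) (\<lambda>Z. ennreal (D p q Z))" by (rule eq[OF T(1) \<rho>q pL qL])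
          also have "\<dots> = density (Q q) (\<lambda>Z. ennreal (\<Phi> p q Z))"
            using m[OF pL qL qL] D_\<Phi> by (intro density_cong) auto
          finally show "Q p = density (Q q) (\<lambda>Z. ennreal (\<Phi> p q Z)) \<and>
              (AE Z in Q q. adm p Z \<and> adm q Z \<and> 0 \<le> \<Phi> p q Z)"
            using ae by (auto elim!: eventually_mono)
        qed
      qed
    qed
  qed
qed

end

section \<open>Rigidity and conditional measures\<close>

text \<open>The sets that agree almost surely with an event of the configuration in \<open>C\<close>
  are closed under complements and countable unions, so generators suffice.\<close>

lemma sigma_sets_AE_eq_vimage:
  assumes C [measurable]: "C \<in> sets borel" and E: "E \<in> sets borel"
    and sets_P: "sets P = sets (conf_space E E)"
    and G: "\<And>A. A \<in> G \<Longrightarrow> \<exists>S\<in>sets (conf_space E C). AE X in P. X \<in> A \<longleftrightarrow> X \<inter> C \<in> S"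
    and A: "A \<in> sigma_sets (conf E E) G"
  shows "\<exists>S\<in>sets (conf_space E C). AE X in P. X \<in> A \<longleftrightarrow> X \<inter> C \<in> S"
  using A
proof induction
  case (Basic a) then show ?case by (rule G)
next
  case Empty then show ?case by (intro bexI[of _ "{}"]) auto
next
  case (Compl a)
  then obtain S where S: "S \<in> sets (conf_space E C)" "AE X in P. X \<in> a \<longleftrightarrow> X \<inter> C \<in> S" by blast
  have "AE X in P. X \<in> conf E E"
    using AE_space[of P] sets_eq_imp_space_eq[OF sets_P] by simp
  with S(2) have "AE X in P. X \<in> conf E E - a \<longleftrightarrow> X \<inter> C \<in> space (conf_space E C) - S"
    by eventually_elim (auto intro: conf_Int)
  then show ?case using S(1) by blast
next
  case (Union a)
  then have "\<forall>i. \<exists>S\<in>sets (conf_space E C). AE X in P. X \<in> a i \<longleftrightarrow> X \<inter> C \<in> S" by blast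
  then obtain S where S: "\<And>i. S i \<in> sets (conf_space E C)" "\<And>i. AE X in P. X \<in> a i \<longleftrightarrow> X \<inter> C \<in> S i"
    by metis
  have "AE X in P. \<forall>i. X \<in> a i \<longleftrightarrow> X \<inter> C \<in> S i" using S(2) by (simp add: AE_all_countable)
  then have "AE X in P. X \<in> (\<Union>i. a i) \<longleftrightarrow> X \<inter> C \<in> (\<Union>i. S i)" by eventually_elim auto
  then show ?case using S(1) by (intro bexI[of _ "\<Union>i. S i"]) auto
qed

text \<open>There are two kinds of generators: counts in subsets of \<open>D\<close> are read off
  from \<open>X \<inter> C\<close>, and null sets agree almost surely with the empty event. The
  completion is thus traded for an almost sure equality.\<close>

lemma completed_algebra_AE_eq_vimage:
  assumes C [measurable]: "C \<in> sets borel" and E [measurable]: "E \<in> sets borel" and "D \<subseteq> C"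
    and sets_P: "sets P = sets (conf_space E E)"
    and A: "A \<in> sets (completed_algebra E P D)"
  shows "\<exists>S\<in>sets (conf_space E C). AE X in P. X \<in> A \<longleftrightarrow> X \<inter> C \<in> S"
proof (rule sigma_sets_AE_eq_vimage[OF C E sets_P])
  have sp: "space P = conf E E" using sets_eq_imp_space_eq[OF sets_P] by simp
  have "sets (outer_algebra E D) \<subseteq> Pow (conf E E)"
    using sets.space_closed[of "outer_algebra E D"]
    by (simp add: outer_algebra_def count_algebra_def space_measure_of_conv)
  moreover have "null_sets (completion P) \<subseteq> Pow (conf E E)"
    using sets.sets_into_space[of _ "completion P"] by (auto simp: sp)
  ultimately show "A \<in> sigma_sets (conf E E) (sets (outer_algebra E D) \<union> null_sets (completion P))"
    using A by (simp add: completed_algebra_def)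
  fix B assume "B \<in> sets (outer_algebra E D) \<union> null_sets (completion P)"
  then consider "B \<in> sets (outer_algebra E D)" | "B \<in> null_sets (completion P)" by auto
  then show "\<exists>S\<in>sets (conf_space E C). AE X in P. X \<in> B \<longleftrightarrow> X \<inter> C \<in> S"
  proof cases
    case 1
    show ?thesis
    proof (rule sigma_sets_AE_eq_vimage[OF C E sets_P])
      show "B \<in> sigma_sets (conf E E)
          {nparticles B -` S \<inter> conf E E | B S. B \<in> sets borel \<and> B \<subseteq> D \<and> S \<in> sets borel}"
        using 1 by (simp add: outer_algebra_def sets_count_algebra)
      fix A assume "A \<in> {nparticles B -` S \<inter> conf E E | B S. B \<in> sets borel \<and> B \<subseteq> D \<and> S \<in> sets borel}"
      then obtain B S where A: "A = nparticles B -` S \<inter> conf E E" "B \<subseteq> D"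
        and [measurable]: "B \<in> sets borel" "S \<in> sets borel" by auto
      have "B \<inter> C = B" using A(2) \<open>D \<subseteq> C\<close> by auto
      then have NB: "nparticles B (X \<inter> C) = nparticles B X" for X
        using nparticles_Int[of B X C] by simp
      have "X \<in> A \<longleftrightarrow> X \<inter> C \<in> {\<xi>\<in>space (conf_space E C). nparticles B \<xi> \<in> S}" if "X \<in> space P" for X
      proof -
        have X: "X \<in> conf E E" using that by (simp add: sp)
        show ?thesis by (simp add: A(1) X conf_Int[OF X] NB)
      qed
      then have "AE X in P. X \<in> A \<longleftrightarrow> X \<inter> C \<in> {\<xi>\<in>space (conf_space E C). nparticles B \<xi> \<in> S}"
        by (rule AE_I2)
      moreover have "{\<xi>\<in>space (conf_space E C). nparticles B \<xi> \<in> S} \<in> sets (conf_space E C)" by measurable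
      ultimately show "\<exists>S\<in>sets (conf_space E C). AE X in P. X \<in> A \<longleftrightarrow> X \<inter> C \<in> S" ..
    qed
  next
    case 2
    have "AE X in P. X \<notin> B" using AE_not_in[OF 2] by (simp add: AE_completion_iff)
    then show ?thesis by (intro bexI[of _ "{}"]) auto
  qed
qed

text \<open>Rigidity is applied to the compact set \<open>closure I\<close>. The particles on
  \<open>closure I - I\<close> belong to \<open>X \<inter> (E - I)\<close>, so their number is known
  from outside and can be subtracted.\<close>

lemma rigid_AE_eq_vimage:
  assumes "open E" "point_process E P" "rigid E P" "open I" "compact (closure I)" "closure I \<subseteq> E"
  shows "\<exists>S\<in>sets (conf_space E (E - I)). AE X in P. nparticles I X = of_nat l \<longleftrightarrow> X \<inter> (E - I) \<in> S"
proof -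
  define C where "C = E - I"
  have C [measurable]: "C \<in> sets borel" and E [measurable]: "E \<in> sets borel"
    using assms by (auto simp: C_def)
  have sets_P: "sets P = sets (conf_space E E)" using assms(2) by (simp add: point_process_def)
  have sp: "space P = conf E E" using sets_eq_imp_space_eq[OF sets_P] by simp
  define B where "B = closure I - I"
  have B [measurable]: "B \<in> sets borel" "B \<subseteq> C" using assms by (auto simp: B_def C_def)
  have cl: "E - closure I \<subseteq> C" using closure_subset[of I] by (auto simp: C_def)
  have "\<exists>S\<in>sets (conf_space E C). AE X in P. X \<in> {X\<in>conf E E. nparticles (closure I) X = of_nat m} \<longleftrightarrow> X \<inter> C \<in> S" for m
  proof (rule completed_algebra_AE_eq_vimage[OF C E cl sets_P])
    have "nparticles (closure I) \<in> borel_measurable (completed_algebra E P (E - closure I))"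
      using assms by (simp add: rigid_def)
    then have "{X\<in>space (completed_algebra E P (E - closure I)). nparticles (closure I) X = of_nat m}
        \<in> sets (completed_algebra E P (E - closure I))" by measurable
    then show "{X\<in>conf E E. nparticles (closure I) X = of_nat m} \<in> sets (completed_algebra E P (E - closure I))"
      by (simp only: completed_algebra_def space_measure_of_conv)
  qed
  then have "\<forall>m. \<exists>S. S \<in> sets (conf_space E C) \<and>
      (AE X in P. X \<in> {X\<in>conf E E. nparticles (closure I) X = of_nat m} \<longleftrightarrow> X \<inter> C \<in> S)"
    unfolding Bex_def by (rule allI)
  from choice[OF this] obtain S where S: "\<And>m. S m \<in> sets (conf_space E C)"
    "\<And>m. AE X in P. X \<in> {X\<in>conf E E. nparticles (closure I) X = of_nat m} \<longleftrightarrow> X \<inter> C \<in> S m"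
    by auto
  \<comment> \<open>\<open>n\<close> is the number of particles on the boundary of \<open>I\<close>;
    the closure then contains \<open>l + n\<close>.\<close>
  define T where "T = (\<Union>n. S (l + n) \<inter> {\<xi>\<in>space (conf_space E C). nparticles B \<xi> = of_nat n})"
  have "T \<in> sets (conf_space E C)" unfolding T_def using S(1) by measurable
  moreover have "AE X in P. nparticles I X = of_nat l \<longleftrightarrow> X \<inter> C \<in> T"
  proof -
    have "AE X in P. \<forall>m. X \<in> {X\<in>conf E E. nparticles (closure I) X = of_nat m} \<longleftrightarrow> X \<inter> C \<in> S m"
      using S(2) by (simp add: AE_all_countable)
    then show ?thesis
      using AE_space
    proof eventually_elim
      case (elim X)
      then have X: "X \<in> conf E E" by (simp add: sp)
      have fin: "finite (X \<inter> closure I)" using conf_finite[OF X] assms by auto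
      have finB: "finite (X \<inter> B)" and finI: "finite (X \<inter> I)"
        using fin closure_subset[of I] by (auto simp: B_def intro: rev_finite_subset)
      have "X \<inter> closure I = (X \<inter> I) \<union> (X \<inter> B)" using closure_subset[of I] by (auto simp: B_def)
      then have card: "card (X \<inter> closure I) = card (X \<inter> I) + card (X \<inter> B)"
        using card_Un_disjoint[OF finI finB] by (auto simp: B_def)
      have "X \<inter> C \<inter> B = X \<inter> B" using B(2) by auto
      then have "X \<inter> C \<in> T \<longleftrightarrow> (\<exists>n. card (X \<inter> closure I) = l + n \<and> card (X \<inter> B) = n)"
        using elim X fin finB conf_Int[OF X, of C]
        by (auto simp: T_def nparticles_eq_of_nat_iff simp del: of_nat_add)
      also have "\<dots> \<longleftrightarrow> nparticles I X = of_nat l"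
        using finI by (auto simp: card nparticles_eq_of_nat_iff)
      finally show ?case by simp
    qed
  qed
  ultimately show ?thesis by (auto simp: C_def)
qed

text \<open>Glueing \<open>Y\<close> to \<open>X \<inter> (E - I)\<close> leaves the outer part
  unchanged and has \<open>Y\<close> as its part in \<open>I\<close>, so the fibre of the rectangle
  is \<open>S2\<close> or empty.\<close>

lemma conditional_measures_rectangle:
  assumes sets_P: "sets P = sets (conf_space E E)" and "conditional_measures E P (E - I) \<kappa>"
    and [measurable]: "E \<in> sets borel" "I \<in> sets borel" and "I \<subseteq> E"
    and S [measurable]: "S1 \<in> sets (conf_space E (E - I))" "S2 \<in> sets (conf_space E I)"
  shows "emeasure P {X\<in>space P. X \<inter> (E - I) \<in> S1 \<and> X \<inter> I \<in> S2} =
    (\<integral>\<^sup>+X. indicator S1 (X \<inter> (E - I)) * emeasure (\<kappa> (X \<inter> (E - I))) S2 \<partial>P)"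
proof -
  let ?C = "E - I"
  let ?A = "{X\<in>space P. X \<inter> ?C \<in> S1 \<and> X \<inter> I \<in> S2}"
  have sp: "space P = conf E E" using sets_eq_imp_space_eq[OF sets_P] by simp
  have EC: "E - ?C = I" using assms by auto
  have "{X\<in>space (conf_space E E). X \<inter> ?C \<in> S1 \<and> X \<inter> I \<in> S2} \<in> sets (conf_space E E)" by measurable
  then have "?A \<in> sets P" by (simp only: sets_P sp space_conf_space)
  then have "emeasure P ?A = (\<integral>\<^sup>+X. emeasure (\<kappa> (X \<inter> ?C)) {Y \<in> conf E I. Y \<union> (X \<inter> ?C) \<in> ?A} \<partial>P)"
    using assms(2) unfolding conditional_measures_def EC by blast
  also have "\<dots> = (\<integral>\<^sup>+X. indicator S1 (X \<inter> ?C) * emeasure (\<kappa> (X \<inter> ?C)) S2 \<partial>P)"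
  proof (rule nn_integral_cong)
    fix X assume "X \<in> space P"
    then have \<xi>: "X \<inter> ?C \<in> conf E ?C" by (auto simp: sp intro: conf_Int)
    have "Y \<union> (X \<inter> ?C) \<in> ?A \<longleftrightarrow> X \<inter> ?C \<in> S1 \<and> Y \<in> S2" if Y: "Y \<in> conf E I" for Y
    proof -
      have "Y \<union> (X \<inter> ?C) \<in> conf E E"
        using Y \<xi> by (auto simp: conf_def Int_Un_distrib2)
      moreover have "(Y \<union> (X \<inter> ?C)) \<inter> ?C = X \<inter> ?C" "(Y \<union> (X \<inter> ?C)) \<inter> I = Y"
        using conf_subset[OF Y] by auto
      ultimately show ?thesis by (simp add: sp)
    qed
    then have "{Y \<in> conf E I. Y \<union> (X \<inter> ?C) \<in> ?A} = (if X \<inter> ?C \<in> S1 then S2 else {})"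
      using sets.sets_into_space[OF S(2)] by auto
    then show "emeasure (\<kappa> (X \<inter> ?C)) {Y \<in> conf E I. Y \<union> (X \<inter> ?C) \<in> ?A} =
        indicator S1 (X \<inter> ?C) * emeasure (\<kappa> (X \<inter> ?C)) S2"
      by simp
  qed
  finally show ?thesis .
qed

section \<open>The Palm formula on the event of exactly l particles in I\<close>

context palm_process
begin

text \<open>The test function demands that the tuple lie in \<open>I\<close> and that the remaining
  configuration avoid \<open>I\<close>, so the tuple is an ordering of \<open>X \<inter> I\<close>.
  The inner sum is then \<open>fact l\<close> on the event and 0 off it; in particular it is
  measurable in \<open>X\<close>, and the Palm formula yields the exact probability.\<close>

lemma palm_formula_conf_tuples:
  assumes [measurable]: "I \<in> sets borel" and "I \<subseteq> E" and closure: "compact (closure I)" "closure I \<subseteq> E"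
    and S [measurable]: "S1 \<in> sets (conf_space E (E - I))" "S2 \<in> sets (conf_space E I)"
  shows "fact l * emeasure P {X\<in>space P. nparticles I X = of_nat l \<and> X \<inter> (E - I) \<in> S1 \<and> X \<inter> I \<in> S2} =
    (\<integral>\<^sup>+p. emeasure (Q p) {Z\<in>space N. Z \<inter> I = {} \<and> Z \<inter> (E - I) \<in> S1} *
       (indicator S2 (p ` {..<l}) * ennreal (\<rho> p)) \<partial>leb_conf_tuples l I)"
proof -
  let ?C = "E - I"
  let ?LI = "leb_conf_tuples l I"
  define A where "A = {p\<in>space ?LI. p ` {..<l} \<in> S2}"
  define B where "B = {Z\<in>space N. Z \<inter> I = {} \<and> Z \<inter> ?C \<in> S1}"
  note LI = leb_conf_tuples_eq_restrict[OF open_E assms(1,2), of l]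
  note ct = conf_tuples_in_sets[OF open_E assms(1,2), of l]
  have "A \<in> sets ?LI" unfolding A_def using measurable_tuple_image[OF open_E assms(1,2)] by measurable
  then have A [measurable]: "A \<in> sets L"
    unfolding LI using ct sets.sets_into_space[OF ct]
    by (subst (asm) sets_restrict_space_iff) (auto simp: Int_absorb2)
  have B [measurable]: "B \<in> sets N"
    unfolding B_def nparticles_eq_0_iff[symmetric] by measurable
  define f :: "(nat \<Rightarrow> 'a) \<times> 'a set \<Rightarrow> ennreal" where "f w = indicator A (fst w) * indicator B (snd w)" for w
  have f: "f \<in> borel_measurable (L \<Otimes>\<^sub>M N)" unfolding f_def by measurable
  let ?T = "{X\<in>space P. nparticles I X = of_nat l \<and> X \<inter> ?C \<in> S1 \<and> X \<inter> I \<in> S2}"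
  have T: "?T \<in> sets P"
  proof -
    have "{X\<in>space N. nparticles I X = of_nat l \<and> X \<inter> ?C \<in> S1 \<and> X \<inter> I \<in> S2} \<in> sets N" by measurable
    then show ?thesis by (simp only: sets_P space_P space_conf_space)
  qed
  have "(\<integral>\<^sup>+X. (\<integral>\<^sup>+x. f (x, X - x ` {..<l}) \<partial>count_space (conf_tuples l X)) \<partial>P) =
      (\<integral>\<^sup>+X. fact l * indicator ?T X \<partial>P)"
  proof (rule nn_integral_cong)
    fix X assume XP: "X \<in> space P"
    then have X: "X \<in> conf E E" by (simp add: space_P)
    define U where "U = {x\<in>conf_tuples l X. x \<in> A \<and> X - x ` {..<l} \<in> B}"
    have fin: "finite (X \<inter> I)"
      using conf_finite[OF X closure] closure_subset[of I] by (auto intro: rev_finite_subset)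
    have "(\<integral>\<^sup>+x. f (x, X - x ` {..<l}) \<partial>count_space (conf_tuples l X)) =
        (\<integral>\<^sup>+x. indicator U x \<partial>count_space (conf_tuples l X))"
      by (intro nn_integral_cong) (auto simp: f_def U_def split: split_indicator)
    also have "\<dots> = emeasure (count_space (conf_tuples l X)) U"
      by (rule nn_integral_indicator) (auto simp: U_def)
    also have "\<dots> = fact l * indicator ?T X"
    proof -
      have "x \<in> U \<longleftrightarrow> x \<in> conf_tuples l (X \<inter> I) \<and> X \<in> ?T" for x
      proof
        assume "x \<in> U"
        then have x: "x \<in> conf_tuples l X" "x \<in> conf_tuples l I" "x ` {..<l} \<in> S2"
          "(X - x ` {..<l}) \<inter> I = {}" "(X - x ` {..<l}) \<inter> ?C \<in> S1"
          by (auto simp: U_def A_def B_def)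
        then have img: "x ` {..<l} = X \<inter> I" by (auto simp: conf_tuples_def)
        moreover from this have "(X - x ` {..<l}) \<inter> ?C = X \<inter> ?C" by auto
        moreover have "card (X \<inter> I) = l"
          using x(1) by (simp add: img[symmetric] card_image conf_tuples_def)
        ultimately show "x \<in> conf_tuples l (X \<inter> I) \<and> X \<in> ?T"
          using x XP fin by (auto simp: conf_tuples_def nparticles_eq_of_nat_iff PiE_iff)
      next
        assume x: "x \<in> conf_tuples l (X \<inter> I) \<and> X \<in> ?T"
        then have img: "x ` {..<l} = X \<inter> I"
          by (intro conf_tuples_image) (auto simp: nparticles_eq_of_nat_iff)
        moreover from this have "(X - x ` {..<l}) \<inter> ?C = X \<inter> ?C" "(X - x ` {..<l}) \<inter> I = {}" by auto
        moreover have "X - x ` {..<l} \<in> conf E E"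
          using conf_mono[OF _ X, of "X - x ` {..<l}"] conf_subset[OF X] by auto
        ultimately show "x \<in> U"
          using x by (auto simp: U_def A_def B_def conf_tuples_def PiE_iff)
      qed
      then have U: "U = (if X \<in> ?T then conf_tuples l (X \<inter> I) else {})" by auto
      show ?thesis
      proof (cases "X \<in> ?T")
        case True
        then have "card (X \<inter> I) = l" by (simp add: nparticles_eq_of_nat_iff)
        from card_conf_tuples[OF fin this]
        have "finite U" "card U = fact l" using U True by auto
        moreover have "U \<subseteq> conf_tuples l X" by (auto simp: U_def)
        ultimately have "emeasure (count_space (conf_tuples l X)) U = of_nat (fact l)"
          by (simp add: emeasure_count_space)
        then show ?thesis using True by simp
      next
        case False
        then have "U = {}" by (simp only: U if_False)
        then show ?thesis using False by simp
      qed
    qed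
    finally show "(\<integral>\<^sup>+x. f (x, X - x ` {..<l}) \<partial>count_space (conf_tuples l X)) = fact l * indicator ?T X" .
  qed
  also have "\<dots> = fact l * emeasure P ?T" by (rule nn_integral_cmult_indicator[OF T])
  finally have "fact l * emeasure P ?T = (\<integral>\<^sup>+q. (\<integral>\<^sup>+X. f (q, X) \<partial>Q q) * ennreal (\<rho> q) \<partial>L)"
    using palm_formula[OF f] by simp
  also have "\<dots> = (\<integral>\<^sup>+q. emeasure (Q q) B * (indicator S2 (q ` {..<l}) * ennreal (\<rho> q)) * indicator (conf_tuples l I) q \<partial>L)"
  proof (rule nn_integral_cong)
    fix q assume q: "q \<in> space L"
    have [measurable]: "B \<in> sets (Q q)" using sets_Q[OF q] by simp
    have "(\<integral>\<^sup>+X. f (q, X) \<partial>Q q) = indicator A q * emeasure (Q q) B"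
      unfolding f_def by (simp add: nn_integral_cmult)
    then show "(\<integral>\<^sup>+X. f (q, X) \<partial>Q q) * ennreal (\<rho> q) =
        emeasure (Q q) B * (indicator S2 (q ` {..<l}) * ennreal (\<rho> q)) * indicator (conf_tuples l I) q"
      by (auto simp: A_def split: split_indicator)
  qed
  also have "\<dots> = (\<integral>\<^sup>+q. emeasure (Q q) B * (indicator S2 (q ` {..<l}) * ennreal (\<rho> q)) \<partial>?LI)"
    unfolding LI using ct sets.sets_into_space[OF ct]
    by (subst nn_integral_restrict_space) (auto simp: Int_absorb2)
  finally show ?thesis by (simp add: B_def)
qed

end

section \<open>Disintegration of the joint law\<close>

lemma fact_inverse_ennreal: "inverse (fact l) * (fact l * x) = (x :: ennreal)"
proof -
  have "fact l = (of_nat (fact l) :: ennreal)" by simp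
  then have "fact l < (\<top> :: ennreal)" by (metis of_nat_less_top)
  then have "fact l / fact l = (1 :: ennreal)" by (intro ennreal_divide_self) auto
  then have "inverse (fact l) * fact l = (1 :: ennreal)" by (simp add: divide_ennreal_def mult.commute)
  then show ?thesis by (simp flip: mult.assoc)
qed

locale rigid_quasi_symmetric_process = quasi_symmetric_process +
  fixes I :: "'a::euclidean_space set" and \<kappa> :: "'a set \<Rightarrow> 'a set measure"
  assumes rigid: "rigid E P"
    and \<rho>_nonneg: "\<And>p. p \<in> {..<l} \<rightarrow>\<^sub>E E \<Longrightarrow> 0 \<le> \<rho> p"
    and open_I: "open I" and compact_closure_I: "compact (closure I)" and closure_I: "closure I \<subseteq> E"
    and conditional_measures: "conditional_measures E P (E - I) \<kappa>"
begin

abbreviation C :: "'a set" where "C \<equiv> E - I"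

abbreviation NC :: "'a set measure" where "NC \<equiv> conf_space E C"

abbreviation NI :: "'a set measure" where "NI \<equiv> conf_space E I"

abbreviation LI :: "(nat \<Rightarrow> 'a) measure" where "LI \<equiv> leb_conf_tuples l I"

text \<open>The unnormalised conditional mass of \<open>S\<close> for the configuration in
  \<open>I\<close>, given the outer configuration \<xi> and relative to the reference tuple
  \<open>q\<close>; at \<open>S = conf E I\<close> it is the normaliser. With values in
  \<open>ennreal\<close> it makes sense before finiteness is known.\<close>

definition H :: "(nat \<Rightarrow> 'a) \<Rightarrow> 'a set set \<Rightarrow> 'a set \<Rightarrow> ennreal" where
  "H q S \<xi> = (\<integral>\<^sup>+p. indicator S (p ` {..<l}) * ennreal (\<rho> p) * ennreal (\<Phi> p q \<xi>) \<partial>LI)"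

text \<open>The density kills all configurations with particles in \<open>I\<close>; on the others
  \<open>Z \<inter> C\<close> is \<open>Z\<close>, so the image measure only changes the underlying
  space. The factor \<open>inverse (fact l)\<close> compensates for counting orderings.\<close>

definition \<nu> :: "(nat \<Rightarrow> 'a) \<Rightarrow> 'a set measure" where
  "\<nu> q = distr (density (Q q) (\<lambda>Z. inverse (fact l) * indicator {Z\<in>space N. Z \<inter> I = {}} Z)) NC (\<lambda>Z. Z \<inter> C)"

text \<open>The conclusion of \<open>palm_density\<close> at one tuple. A single good tuple is fixed
  in the end, so that the null sets of configurations depend on it alone.\<close>

definition good :: "(nat \<Rightarrow> 'a) \<Rightarrow> bool" where
  "good q \<longleftrightarrow> q \<in> space L \<and> (AE p in L. 0 < \<rho> p \<longrightarrow>
    Q p = density (Q q) (\<lambda>Z. ennreal (\<Phi> p q Z)) \<and>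
    (AE Z in Q q. adm p Z \<and> adm q Z \<and> 0 \<le> \<Phi> p q Z))"

lemma I_borel [measurable]: "I \<in> sets borel" and C_borel: "C \<in> sets borel"
  using open_I open_E by auto

lemma I_subset: "I \<subseteq> E"
  using closure_I closure_subset by blast

lemma E_Diff_C: "E - C = I"
  using I_subset by auto

lemma measurable_Int_C: "(\<lambda>X. X \<inter> C) \<in> N \<rightarrow>\<^sub>M NC"
  using C_borel E_borel by (rule measurable_conf_Int)

lemma measurable_incl_C: "(\<lambda>X. X) \<in> NC \<rightarrow>\<^sub>M N"
  using C_borel E_borel by (rule measurable_conf_incl) auto

lemma measurable_incl_LI: "(\<lambda>p. p) \<in> LI \<rightarrow>\<^sub>M L"
  using open_E I_borel I_subset by (rule measurable_leb_conf_tuples_incl)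

lemma measurable_image_LI [measurable]: "(\<lambda>p. p ` {..<l}) \<in> LI \<rightarrow>\<^sub>M NI"
  using open_E I_borel I_subset by (rule measurable_tuple_image)

lemma measurable_\<rho>_LI [measurable]: "\<rho> \<in> borel_measurable LI"
  using measurable_compose[OF measurable_incl_LI \<rho>_measurable] .

lemma space_LI_subset: "p \<in> conf_tuples l I \<Longrightarrow> p \<in> space L"
  using I_subset by (auto simp: conf_tuples_def PiE_iff)

sublocale LI: sigma_finite_measure LI
  using open_E I_borel I_subset by (rule sigma_finite_leb_conf_tuples)

lemma AE_LI: "(AE p in L. R p) \<Longrightarrow> (AE p in LI. R p)"
  unfolding leb_conf_tuples_eq_restrict[OF open_E I_borel I_subset]
  using conf_tuples_in_sets[OF open_E I_borel I_subset, of l]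
    sets.sets_into_space[OF conf_tuples_in_sets[OF open_E I_borel I_subset, of l]]
  by (subst AE_restrict_space_iff) (auto elim!: eventually_mono simp: Int_absorb2)

lemma measurable_H_integrand:
  assumes [measurable]: "S \<in> sets NI" and q: "q \<in> space L" and h: "h \<in> M \<rightarrow>\<^sub>M N"
  shows "(\<lambda>(x, p). indicator S (p ` {..<l}) * ennreal (\<rho> p) * ennreal (\<Phi> p q (h x)))
    \<in> borel_measurable (M \<Otimes>\<^sub>M LI)"
proof -
  have [measurable]: "(\<lambda>w. \<Phi> (snd w) q (h (fst w))) \<in> borel_measurable (M \<Otimes>\<^sub>M LI)"
    by (rule measurable_\<Phi>[OF measurable_compose[OF measurable_snd measurable_incl_LI] _
          measurable_compose[OF measurable_fst h]]) (use q in simp)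
  show ?thesis unfolding case_prod_beta by measurable
qed

lemma measurable_H [measurable]:
  assumes "S \<in> sets NI" "q \<in> space L"
  shows "H q S \<in> borel_measurable NC"
  unfolding H_def
  by (rule LI.borel_measurable_nn_integral, rule measurable_H_integrand[OF assms measurable_incl_C])

lemma sets_\<nu> [simp]: "sets (\<nu> q) = sets NC"
  by (simp add: \<nu>_def)

lemma disjoint_I_sets [measurable]: "{Z\<in>space N. Z \<inter> I = {}} \<in> sets N"
  unfolding nparticles_eq_0_iff[symmetric] by measurable

lemma measurable_Q: "q \<in> space L \<Longrightarrow> f \<in> N \<rightarrow>\<^sub>M M \<Longrightarrow> f \<in> Q q \<rightarrow>\<^sub>M M"
  using measurable_cong_sets[OF sets_Q refl] by blast

lemma nn_integral_\<nu>:
  assumes q: "q \<in> space L" and h [measurable]: "h \<in> borel_measurable NC"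
  shows "(\<integral>\<^sup>+\<xi>. h \<xi> \<partial>\<nu> q) =
    (\<integral>\<^sup>+Z. inverse (fact l) * indicator {Z\<in>space N. Z \<inter> I = {}} Z * h (Z \<inter> C) \<partial>Q q)"
proof -
  let ?d = "\<lambda>Z. inverse (fact l) * indicator {Z\<in>space N. Z \<inter> I = {}} Z :: ennreal"
  have d: "?d \<in> borel_measurable (Q q)"
    by (rule measurable_Q[OF q]) (use disjoint_I_sets in measurable)
  have C: "(\<lambda>Z. Z \<inter> C) \<in> Q q \<rightarrow>\<^sub>M NC" by (rule measurable_Q[OF q measurable_Int_C])
  have "(\<integral>\<^sup>+\<xi>. h \<xi> \<partial>\<nu> q) = (\<integral>\<^sup>+Z. h (Z \<inter> C)
      \<partial>density (Q q) (\<lambda>Z. inverse (fact l) * indicator {Z\<in>space N. Z \<inter> I = {}} Z))"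
    unfolding \<nu>_def
  proof (rule nn_integral_distr)
    show "(\<lambda>Z. Z \<inter> C) \<in> density (Q q) ?d \<rightarrow>\<^sub>M NC"
      using C unfolding measurable_cong_sets[OF sets_density refl] .
    show "h \<in> borel_measurable (distr (density (Q q) ?d) NC (\<lambda>Z. Z \<inter> C))"
      using h unfolding measurable_cong_sets[OF sets_distr refl] .
  qed
  also have "\<dots> = (\<integral>\<^sup>+Z. inverse (fact l) * indicator {Z\<in>space N. Z \<inter> I = {}} Z * h (Z \<inter> C) \<partial>Q q)"
    by (rule nn_integral_density[OF d measurable_compose[OF C h]])
  finally show ?thesis .
qed

text \<open>\<open>\<nu> q\<close> is carried by configurations without particles in
  \<open>I\<close>, which the map to \<open>C\<close> leaves fixed. As \<open>R\<close> need not be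
  measurable, a measurable null set \<open>B\<close> covering the exceptions is transported.\<close>

lemma AE_\<nu>:
  assumes q: "q \<in> space L" and ae: "AE Z in Q q. Z \<inter> I = {} \<longrightarrow> R Z"
  shows "AE \<xi> in \<nu> q. R \<xi>"
proof -
  obtain B where B: "B \<in> null_sets (Q q)" "{Z\<in>space (Q q). \<not> (Z \<inter> I = {} \<longrightarrow> R Z)} \<subseteq> B"
    using ae by (auto elim!: AE_E)
  have sp: "space (Q q) = conf E E" using sets_eq_imp_space_eq[OF sets_Q[OF q]] by simp
  have BN [measurable]: "B \<in> sets N" using B(1) sets_Q[OF q] by auto
  define B' where "B' = {\<xi>\<in>space NC. \<xi> \<in> B}"
  have B' [measurable]: "B' \<in> sets NC"
    using measurable_sets[OF measurable_incl_C BN] by (simp add: B'_def Collect_conj_eq Int_commute)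
  have "emeasure (\<nu> q) B' = (\<integral>\<^sup>+\<xi>. indicator B' \<xi> \<partial>\<nu> q)"
    by (rule nn_integral_indicator[symmetric]) simp
  also have "\<dots> = (\<integral>\<^sup>+Z. inverse (fact l) * indicator {Z\<in>space N. Z \<inter> I = {}} Z * indicator B' (Z \<inter> C) \<partial>Q q)"
    by (rule nn_integral_\<nu>[OF q]) measurable
  also have "\<dots> = (\<integral>\<^sup>+Z. 0 \<partial>Q q)"
  proof (rule nn_integral_cong_AE)
    show "AE Z in Q q. inverse (fact l) * indicator {Z\<in>space N. Z \<inter> I = {}} Z * indicator B' (Z \<inter> C) = (0 :: ennreal)"
      using AE_not_in[OF B(1)] AE_space
    proof eventually_elim
      case (elim Z)
      have "Z \<inter> C = Z" if "Z \<inter> I = {}" using that elim(2) conf_subset[of Z E E] by (auto simp: sp)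
      then show ?case using elim(1) by (auto simp: B'_def split: split_indicator)
    qed
  qed
  finally have "emeasure (\<nu> q) B' = 0" by simp
  then show ?thesis
  proof (intro AE_I[of _ _ B'])
    show "{\<xi>\<in>space (\<nu> q). \<not> R \<xi>} \<subseteq> B'"
    proof
      fix \<xi> assume "\<xi> \<in> {\<xi>\<in>space (\<nu> q). \<not> R \<xi>}"
      then have \<xi>: "\<xi> \<in> conf E C" "\<not> R \<xi>" by (auto simp: \<nu>_def)
      have "\<xi> \<inter> I = {}" using conf_subset[OF \<xi>(1)] by auto
      moreover have "\<xi> \<in> space (Q q)" using measurable_space[OF measurable_incl_C] \<xi>(1) by (simp add: sp)
      ultimately show "\<xi> \<in> B'" using B(2) \<xi> by (auto simp: B'_def)
    qed
  qed simp_all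
qed

text \<open>In the Palm formula for the event, \<open>Q p\<close> is replaced by its density with
  respect to \<open>Q q\<close>; Tonelli then moves the integral over \<open>p\<close> inside, where
  it becomes \<open>H\<close>.\<close>

lemma joint_law:
  assumes good: "good q" and S [measurable]: "S1 \<in> sets NC" "S2 \<in> sets NI"
  shows "emeasure P {X\<in>space P. nparticles I X = of_nat l \<and> X \<inter> C \<in> S1 \<and> X \<inter> I \<in> S2} =
    (\<integral>\<^sup>+\<xi>. H q S2 \<xi> * indicator S1 \<xi> \<partial>\<nu> q)" (is "?p = _")
proof -
  have q: "q \<in> space L" using good by (simp add: good_def)
  interpret Qq: prob_space "Q q" by (rule prob_space_Q[OF q])
  interpret LQ: pair_sigma_finite LI "Q q" ..
  define B where "B = {Z\<in>space N. Z \<inter> I = {} \<and> Z \<inter> C \<in> S1}"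
  have B [measurable]: "B \<in> sets N"
    unfolding B_def nparticles_eq_0_iff[symmetric] by measurable
  have sp: "space (Q q) = conf E E" using sets_eq_imp_space_eq[OF sets_Q[OF q]] by simp
  have m\<Phi>: "(\<lambda>Z. \<Phi> p q Z) \<in> borel_measurable (Q q)" if "p \<in> space L" for p
    by (rule measurable_Q[OF q], rule measurable_\<Phi>) (use that q in auto)
  have idN: "(\<lambda>Z. Z) \<in> Q q \<rightarrow>\<^sub>M N" by (rule measurable_Q[OF q]) simp
  have BQ: "B \<in> sets (Q q)" using B sets_Q[OF q] by simp
  have "fact l * ?p = (\<integral>\<^sup>+p. emeasure (Q p) B * (indicator S2 (p ` {..<l}) * ennreal (\<rho> p)) \<partial>LI)"
    using palm_formula_conf_tuples[OF I_borel I_subset compact_closure_I closure_I S] by (simp add: B_def)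
  also have "\<dots> = (\<integral>\<^sup>+p. (\<integral>\<^sup>+Z. indicator B Z *
      (indicator S2 (p ` {..<l}) * ennreal (\<rho> p) * ennreal (\<Phi> p q Z)) \<partial>Q q) \<partial>LI)"
  proof (rule nn_integral_cong_AE)
    have "AE p in LI. 0 < \<rho> p \<longrightarrow> Q p = density (Q q) (\<lambda>Z. ennreal (\<Phi> p q Z))"
      by (rule AE_LI) (use good in \<open>auto simp: good_def elim!: eventually_mono\<close>)
    then show "AE p in LI. emeasure (Q p) B * (indicator S2 (p ` {..<l}) * ennreal (\<rho> p)) =
        (\<integral>\<^sup>+Z. indicator B Z * (indicator S2 (p ` {..<l}) * ennreal (\<rho> p) * ennreal (\<Phi> p q Z)) \<partial>Q q)"
      using AE_space
    proof eventually_elim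
      case (elim p)
      then have p: "p \<in> space L" using space_LI_subset by simp
      show ?case
      proof (cases "0 < \<rho> p")
        case True
        then have "emeasure (Q p) B = (\<integral>\<^sup>+Z. ennreal (\<Phi> p q Z) * indicator B Z \<partial>Q q)"
          using elim(1) m\<Phi>[OF p] BQ by (simp add: emeasure_density)
        then have "emeasure (Q p) B * (indicator S2 (p ` {..<l}) * ennreal (\<rho> p)) =
            (\<integral>\<^sup>+Z. ennreal (\<Phi> p q Z) * indicator B Z * (indicator S2 (p ` {..<l}) * ennreal (\<rho> p)) \<partial>Q q)"
          using m\<Phi>[OF p] BQ by (simp add: nn_integral_multc)
        then show ?thesis by (simp add: ac_simps)
      next
        \<comment> \<open>Tuples without positive \<rho> have weight 0, so the arbitrary value of
          \<open>Q p\<close> there is harmless.\<close>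
        case False
        then have "ennreal (\<rho> p) = 0" by (simp add: ennreal_neg)
        then show ?thesis by simp
      qed
    qed
  qed
  also have "\<dots> = (\<integral>\<^sup>+Z. (\<integral>\<^sup>+p. indicator B Z *
      (indicator S2 (p ` {..<l}) * ennreal (\<rho> p) * ennreal (\<Phi> p q Z)) \<partial>LI) \<partial>Q q)"
  proof (rule LQ.Fubini'[symmetric])
    have prod: "(\<lambda>w. indicator S2 (fst w ` {..<l}) * ennreal (\<rho> (fst w)) * ennreal (\<Phi> (fst w) q (snd w)))
        \<in> borel_measurable (LI \<Otimes>\<^sub>M Q q)"
      using measurable_compose[OF measurable_pair_swap' measurable_H_integrand[OF S(2) q idN]]
      by (simp add: case_prod_beta)
    show "(\<lambda>(p, Z). indicator B Z * (indicator S2 (p ` {..<l}) * ennreal (\<rho> p) * ennreal (\<Phi> p q Z)))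
        \<in> borel_measurable (LI \<Otimes>\<^sub>M Q q)"
      unfolding case_prod_beta
      by (rule borel_measurable_times_ennreal[OF measurable_compose[OF measurable_snd borel_measurable_indicator[OF BQ]] prod])
  qed
  also have "\<dots> = (\<integral>\<^sup>+Z. indicator {Z\<in>space N. Z \<inter> I = {}} Z * (H q S2 (Z \<inter> C) * indicator S1 (Z \<inter> C)) \<partial>Q q)"
  proof (rule nn_integral_cong)
    fix Z assume "Z \<in> space (Q q)"
    then have Z: "Z \<in> conf E E" by (simp add: sp)
    have "(\<integral>\<^sup>+p. indicator B Z * (indicator S2 (p ` {..<l}) * ennreal (\<rho> p) * ennreal (\<Phi> p q Z)) \<partial>LI) =
        indicator B Z * H q S2 Z"
      unfolding H_def
      by (rule nn_integral_cmult)
        (use measurable_compose[OF measurable_Pair1' measurable_H_integrand[OF S(2) q idN], of Z] Z in \<open>simp add: sp\<close>)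
    moreover have "Z \<inter> C = Z" if "Z \<inter> I = {}" using that conf_subset[OF Z] by auto
    ultimately show "(\<integral>\<^sup>+p. indicator B Z * (indicator S2 (p ` {..<l}) * ennreal (\<rho> p) * ennreal (\<Phi> p q Z)) \<partial>LI) =
        indicator {Z\<in>space N. Z \<inter> I = {}} Z * (H q S2 (Z \<inter> C) * indicator S1 (Z \<inter> C))"
      using Z by (auto simp: B_def split: split_indicator)
  qed
  finally have "?p = inverse (fact l) *
      (\<integral>\<^sup>+Z. indicator {Z\<in>space N. Z \<inter> I = {}} Z * (H q S2 (Z \<inter> C) * indicator S1 (Z \<inter> C)) \<partial>Q q)"
    using fact_inverse_ennreal[of l ?p] by simp
  also have "\<dots> = (\<integral>\<^sup>+Z. inverse (fact l) * indicator {Z\<in>space N. Z \<inter> I = {}} Z *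
      (H q S2 (Z \<inter> C) * indicator S1 (Z \<inter> C)) \<partial>Q q)"
    unfolding mult.assoc
    by (rule nn_integral_cmult[symmetric], intro measurable_Q[OF q] borel_measurable_times_ennreal
        borel_measurable_indicator disjoint_I_sets measurable_compose[OF measurable_Int_C measurable_H[OF S(2) q]]
        measurable_compose[OF measurable_Int_C borel_measurable_indicator[OF S(1)]])
  also have "\<dots> = (\<integral>\<^sup>+\<xi>. H q S2 \<xi> * indicator S1 \<xi> \<partial>\<nu> q)"
    by (rule nn_integral_\<nu>[OF q, symmetric])
      (intro borel_measurable_times_ennreal measurable_H[OF S(2) q] borel_measurable_indicator S(1))
  finally show ?thesis .
qed

section \<open>Identification of the conditional measures\<close>

text \<open>The desired formula for one fixed reference tuple, with the normaliser still in
  \<open>ennreal\<close>. The sign clause is kept because \<open>ennreal\<close> truncates negative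
  values, whereas the theorem normalises by a real integral.\<close>

definition regular :: "(nat \<Rightarrow> 'a) \<Rightarrow> 'a set \<Rightarrow> bool" where
  "regular q \<xi> \<longleftrightarrow> H q (conf E I) \<xi> \<noteq> 0 \<and> H q (conf E I) \<xi> \<noteq> \<infinity> \<and>
    (AE p in LI. 0 < \<rho> p \<longrightarrow> 0 \<le> \<Phi> p q \<xi>) \<and>
    \<kappa> \<xi> = distr (density LI (\<lambda>p. ennreal (\<rho> p) * ennreal (\<Phi> p q \<xi>) / H q (conf E I) \<xi>)) NI (\<lambda>p. p ` {..<l})"

lemma measurable_\<Phi>_LI:
  assumes "q \<in> space L" "\<xi> \<in> conf E C"
  shows "(\<lambda>p. \<Phi> p q \<xi>) \<in> borel_measurable LI"
  using assms measurable_space[OF measurable_incl_C, of \<xi>]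
  by (intro measurable_\<Phi> measurable_incl_LI) auto

text \<open>\<open>good\<close> gives the sign outside a null set of configurations that depends on
  \<open>p\<close>. Fubini exchanges the quantifiers, so that a fixed outer configuration has the
  sign for almost every \<open>p\<close>.\<close>

lemma AE_\<nu>_nonneg:
  assumes "good q"
  shows "AE \<xi> in \<nu> q. AE p in LI. 0 < \<rho> p \<longrightarrow> 0 \<le> \<Phi> p q \<xi>"
proof -
  have q: "q \<in> space L" using assms by (simp add: good_def)
  interpret Qq: prob_space "Q q" by (rule prob_space_Q[OF q])
  interpret LQ: pair_sigma_finite L "Q q" ..
  have "(\<lambda>w. \<Phi> (fst w) q (snd w)) \<in> borel_measurable (L \<Otimes>\<^sub>M N)"
    by (rule measurable_\<Phi>) (use q in auto)
  then have "Measurable.pred (L \<Otimes>\<^sub>M N) (\<lambda>w. 0 < \<rho> (fst w) \<longrightarrow> 0 \<le> \<Phi> (fst w) q (snd w))" by measurable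
  then have "Measurable.pred (L \<Otimes>\<^sub>M Q q) (\<lambda>w. 0 < \<rho> (fst w) \<longrightarrow> 0 \<le> \<Phi> (fst w) q (snd w))"
    by (simp only: measurable_cong_sets[OF sets_pair_measure_cong[OF refl sets_Q[OF q]] refl])
  moreover have "AE p in L. AE Z in Q q. 0 < \<rho> p \<longrightarrow> 0 \<le> \<Phi> p q Z"
    using assms[unfolded good_def, THEN conjunct2]
  proof eventually_elim
    case (elim p)
    show ?case
    proof (cases "0 < \<rho> p")
      case True
      with elim have "AE Z in Q q. adm p Z \<and> adm q Z \<and> 0 \<le> \<Phi> p q Z" by blast
      then show ?thesis by (rule eventually_mono) blast
    qed simp
  qed
  ultimately have "AE Z in Q q. AE p in L. 0 < \<rho> p \<longrightarrow> 0 \<le> \<Phi> p q Z"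
    using LQ.AE_commute[of "\<lambda>p Z. 0 < \<rho> p \<longrightarrow> 0 \<le> \<Phi> p q Z"] by (simp add: pred_def)
  then have "AE Z in Q q. AE p in LI. 0 < \<rho> p \<longrightarrow> 0 \<le> \<Phi> p q Z"
    by eventually_elim (rule AE_LI)
  then have "AE Z in Q q. Z \<inter> I = {} \<longrightarrow> (AE p in LI. 0 < \<rho> p \<longrightarrow> 0 \<le> \<Phi> p q Z)"
    by (rule eventually_mono) (rule impI)
  then show ?thesis by (rule AE_\<nu>[OF q])
qed

lemma measurable_\<kappa>: "\<kappa> \<in> NC \<rightarrow>\<^sub>M subprob_algebra NI"
  using conditional_measures unfolding conditional_measures_def E_Diff_C
  by (auto intro: measurable_prob_algebraD)

lemma prob_space_\<kappa>: "\<xi> \<in> conf E C \<Longrightarrow> prob_space (\<kappa> \<xi>)"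
  and sets_\<kappa>: "\<xi> \<in> conf E C \<Longrightarrow> sets (\<kappa> \<xi>) = sets NI"
proof -
  assume "\<xi> \<in> conf E C"
  then have \<xi>: "\<xi> \<in> space NC" by (simp only: space_conf_space)
  have "\<kappa> \<in> NC \<rightarrow>\<^sub>M prob_algebra NI"
    using conditional_measures unfolding conditional_measures_def E_Diff_C by (rule conjunct1)
  from measurable_space[OF this \<xi>] show "prob_space (\<kappa> \<xi>)" "sets (\<kappa> \<xi>) = sets NI"
    by (auto simp: space_prob_algebra)
qed

text \<open>Disintegration by \<kappa> and by \<open>\<nu> q\<close> describe the same joint law of
  outer and inner configuration on the event. With the whole space as inner event this makes
  \<open>H q (conf E I)\<close> the density of the outer law; uniqueness of densities then compares
  the inner masses on a countable generator.\<close>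

lemma AE_regular:
  assumes good: "good q"
  shows "AE X in P. nparticles I X = of_nat l \<longrightarrow> regular q (X \<inter> C)"
proof -
  have q: "q \<in> space L" using good by (simp add: good_def)
  interpret P: prob_space P by (rule prob_space_P)
  obtain S where S: "S \<in> sets NC" and ae_S: "AE X in P. nparticles I X = of_nat l \<longleftrightarrow> X \<inter> C \<in> S"
    using rigid_AE_eq_vimage[OF open_E point_process rigid open_I compact_closure_I closure_I] by blast
  have PN: "f \<in> P \<rightarrow>\<^sub>M M \<longleftrightarrow> f \<in> N \<rightarrow>\<^sub>M M" for f and M :: "'z measure"
    using measurable_cong_sets[OF sets_P refl] by blast
  have C_P: "(\<lambda>X. X \<inter> C) \<in> P \<rightarrow>\<^sub>M NC" unfolding PN by (rule measurable_Int_C)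
  \<comment> \<open>\<open>D\<close> is the law of the outer configuration and \<open>\<mu>\<close>
    its part on the event, which rigidity expresses through \<open>S\<close>; in this way the event
    becomes one about the argument of \<kappa>.\<close>
  define D where "D = distr P NC (\<lambda>X. X \<inter> C)"
  define \<mu> where "\<mu> = density D (indicator S)"
  have sets_D: "sets D = sets NC" and sets_\<mu>: "sets \<mu> = sets NC" by (simp_all add: D_def \<mu>_def)
  have top: "conf E I \<in> sets NI" using sets.top[of NI] by simp
  have mH: "H q S2 \<in> borel_measurable (\<nu> q)" if "S2 \<in> sets NI" for S2
    using measurable_H[OF that q] unfolding measurable_cong_sets[OF sets_\<nu> refl] .
  let ?H = "H q (conf E I)"

  have key: "(\<integral>\<^sup>+\<xi>. emeasure (\<kappa> \<xi>) S2 * indicator S1 \<xi> \<partial>\<mu>) = (\<integral>\<^sup>+\<xi>. H q S2 \<xi> * indicator S1 \<xi> \<partial>\<nu> q)"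
    if S1: "S1 \<in> sets NC" and S2: "S2 \<in> sets NI" for S1 S2
  proof -
    have \<kappa>S2: "(\<lambda>\<xi>. emeasure (\<kappa> \<xi>) S2) \<in> borel_measurable NC"
      using measurable_emeasure_kernel[OF measurable_\<kappa> S2] .
    have m1: "(\<lambda>\<xi>. emeasure (\<kappa> \<xi>) S2 * indicator S1 \<xi>) \<in> borel_measurable NC"
      by (intro borel_measurable_times_ennreal \<kappa>S2 borel_measurable_indicator S1)
    have m2: "(\<lambda>\<xi>. indicator S \<xi> * (emeasure (\<kappa> \<xi>) S2 * indicator S1 \<xi>)) \<in> borel_measurable NC"
      by (intro borel_measurable_times_ennreal m1 borel_measurable_indicator S)
    have "(\<integral>\<^sup>+\<xi>. emeasure (\<kappa> \<xi>) S2 * indicator S1 \<xi> \<partial>\<mu>) =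
        (\<integral>\<^sup>+\<xi>. indicator S \<xi> * (emeasure (\<kappa> \<xi>) S2 * indicator S1 \<xi>) \<partial>D)"
      unfolding \<mu>_def
      by (rule nn_integral_density) (use S m1 in \<open>simp_all only: measurable_cong_sets[OF sets_D refl] borel_measurable_indicator\<close>)
    also have "\<dots> = (\<integral>\<^sup>+X. indicator S (X \<inter> C) * (emeasure (\<kappa> (X \<inter> C)) S2 * indicator S1 (X \<inter> C)) \<partial>P)"
      unfolding D_def
      by (rule nn_integral_distr[OF C_P]) (use m2 in \<open>simp only: measurable_cong_sets[OF sets_distr refl]\<close>)
    also have "\<dots> = (\<integral>\<^sup>+X. indicator (S1 \<inter> S) (X \<inter> C) * emeasure (\<kappa> (X \<inter> C)) S2 \<partial>P)"
      by (rule nn_integral_cong) (auto split: split_indicator)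
    also have "\<dots> = emeasure P {X\<in>space P. X \<inter> C \<in> S1 \<inter> S \<and> X \<inter> I \<in> S2}"
      by (rule conditional_measures_rectangle[OF sets_P conditional_measures E_borel I_borel I_subset _ S2, symmetric])
        (use S1 S in blast)
    also have "\<dots> = emeasure P {X\<in>space P. nparticles I X = of_nat l \<and> X \<inter> C \<in> S1 \<and> X \<inter> I \<in> S2}"
    proof (rule emeasure_eq_AE)
      show "AE X in P. X \<in> {X\<in>space P. X \<inter> C \<in> S1 \<inter> S \<and> X \<inter> I \<in> S2} \<longleftrightarrow>
          X \<in> {X\<in>space P. nparticles I X = of_nat l \<and> X \<inter> C \<in> S1 \<and> X \<inter> I \<in> S2}"
        using ae_S by eventually_elim auto
      have m: "{X\<in>space N. X \<inter> C \<in> T} \<in> sets N" if "T \<in> sets NC" for T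
        using measurable_sets[OF measurable_Int_C that] by (simp only: vimage_def Int_def conj_commute mem_Collect_eq)
      have mI: "{X\<in>space N. X \<inter> I \<in> S2} \<in> sets N"
        using measurable_sets[OF measurable_conf_Int[OF I_borel E_borel] S2]
        by (simp only: vimage_def Int_def conj_commute mem_Collect_eq)
      have ml: "{X\<in>space N. nparticles I X = of_nat l} \<in> sets N" by measurable
      have P_N: "sets P = sets N" "space P = space N" using sets_P sets_eq_imp_space_eq[OF sets_P] by auto
      show "{X\<in>space P. X \<inter> C \<in> S1 \<inter> S \<and> X \<inter> I \<in> S2} \<in> sets P"
        unfolding P_N by (intro sets.sets_Collect_conj m mI sets.Int S1 S)
      show "{X\<in>space P. nparticles I X = of_nat l \<and> X \<inter> C \<in> S1 \<and> X \<inter> I \<in> S2} \<in> sets P"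
        unfolding P_N by (intro sets.sets_Collect_conj m mI ml S1)
    qed
    also have "\<dots> = (\<integral>\<^sup>+\<xi>. H q S2 \<xi> * indicator S1 \<xi> \<partial>\<nu> q)" by (rule joint_law[OF good S1 S2])
    finally show ?thesis .
  qed

  have \<mu>: "\<mu> = density (\<nu> q) ?H"
  proof (rule measure_eqI)
    show "sets \<mu> = sets (density (\<nu> q) ?H)" by (simp add: sets_\<mu>)
    fix S1 assume "S1 \<in> sets \<mu>"
    then have S1: "S1 \<in> sets NC" by (simp add: sets_\<mu>)
    have "emeasure \<mu> S1 = (\<integral>\<^sup>+\<xi>. indicator S1 \<xi> \<partial>\<mu>)"
      using S1 by (intro nn_integral_indicator[symmetric]) (simp add: sets_\<mu>)
    \<comment> \<open>Since \<open>\<kappa> \<xi>\<close> has total mass 1, the case of the full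
      inner space in \<open>key\<close> computes \<open>\<mu>\<close> itself.\<close>
    also have "\<dots> = (\<integral>\<^sup>+\<xi>. emeasure (\<kappa> \<xi>) (conf E I) * indicator S1 \<xi> \<partial>\<mu>)"
    proof (rule nn_integral_cong)
      fix \<xi> assume "\<xi> \<in> space \<mu>"
      then have \<xi>: "\<xi> \<in> conf E C" using sets_eq_imp_space_eq[OF sets_\<mu>] by simp
      have "space (\<kappa> \<xi>) = conf E I" using sets_eq_imp_space_eq[OF sets_\<kappa>[OF \<xi>]] by simp
      then have "emeasure (\<kappa> \<xi>) (conf E I) = 1"
        using prob_space.emeasure_space_1[OF prob_space_\<kappa>[OF \<xi>]] by simp
      then show "indicator S1 \<xi> = emeasure (\<kappa> \<xi>) (conf E I) * indicator S1 \<xi>" by simp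
    qed
    also have "\<dots> = emeasure (density (\<nu> q) ?H) S1"
      unfolding key[OF S1 top] using S1 by (intro emeasure_density[symmetric] mH[OF top]) simp
    finally show "emeasure \<mu> S1 = emeasure (density (\<nu> q) ?H) S1" .
  qed

  obtain \<G> where \<G>: "countable \<G>" "\<G> \<subseteq> Pow (conf E I)" "Int_stable \<G>" "conf E I \<in> \<G>"
    "sets NI = sigma_sets (conf E I) \<G>"
    using conf_space_countably_generated[OF open_E I_borel] by blast
  have \<G>_sets: "S2 \<in> sets NI" if "S2 \<in> \<G>" for S2 using that \<G>(5) by auto

  \<comment> \<open>The total mass of \<open>\<nu> q\<close> is at most \<open>1 / l!\<close>.
    Sigma-finiteness is what uniqueness of densities asks for.\<close>
  have sf: "sigma_finite_measure (\<nu> q)"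
  proof -
    interpret Qq: prob_space "Q q" by (rule prob_space_Q[OF q])
    have "emeasure (\<nu> q) (space (\<nu> q)) = (\<integral>\<^sup>+\<xi>. 1 \<partial>\<nu> q)" by simp
    also have "\<dots> = (\<integral>\<^sup>+Z. inverse (fact l) * indicator {Z\<in>space N. Z \<inter> I = {}} Z * 1 \<partial>Q q)"
      by (rule nn_integral_\<nu>[OF q]) simp
    also have "\<dots> \<le> (\<integral>\<^sup>+Z. inverse (fact l) \<partial>Q q)"
      by (rule nn_integral_mono) (simp split: split_indicator)
    also have "\<dots> = inverse (fact l)" using Qq.emeasure_space_1 by simp
    finally have "emeasure (\<nu> q) (space (\<nu> q)) \<noteq> \<infinity>"
      by (auto simp: top_unique)
    then have "finite_measure (\<nu> q)" by (rule finite_measureI)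
    then show ?thesis by (simp add: finite_measure_def)
  qed
  interpret \<nu>: sigma_finite_measure "\<nu> q" by (rule sf)

  have "AE \<xi> in \<nu> q. ?H \<xi> * emeasure (\<kappa> \<xi>) S2 = H q S2 \<xi>" if S2: "S2 \<in> \<G>" for S2
  proof (rule \<nu>.density_unique2)
    have \<kappa>S2: "(\<lambda>\<xi>. emeasure (\<kappa> \<xi>) S2) \<in> borel_measurable (\<nu> q)"
      using measurable_emeasure_kernel[OF measurable_\<kappa> \<G>_sets[OF S2]]
      unfolding measurable_cong_sets[OF sets_\<nu> refl] .
    show "(\<lambda>\<xi>. ?H \<xi> * emeasure (\<kappa> \<xi>) S2) \<in> borel_measurable (\<nu> q)"
      by (intro borel_measurable_times_ennreal mH top \<kappa>S2)
    show "H q S2 \<in> borel_measurable (\<nu> q)" by (rule mH[OF \<G>_sets[OF S2]])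
    fix S1 assume S1: "S1 \<in> sets (\<nu> q)"
    have "(\<integral>\<^sup>+\<xi>\<in>S1. ?H \<xi> * emeasure (\<kappa> \<xi>) S2 \<partial>\<nu> q) =
        (\<integral>\<^sup>+\<xi>. ?H \<xi> * (emeasure (\<kappa> \<xi>) S2 * indicator S1 \<xi>) \<partial>\<nu> q)" by (simp only: mult.assoc)
    also have "\<dots> = (\<integral>\<^sup>+\<xi>. emeasure (\<kappa> \<xi>) S2 * indicator S1 \<xi> \<partial>\<mu>)"
      unfolding \<mu>
      by (rule nn_integral_density[symmetric, OF mH[OF top]])
        (intro borel_measurable_times_ennreal \<kappa>S2 borel_measurable_indicator S1)
    also have "\<dots> = (\<integral>\<^sup>+\<xi>\<in>S1. H q S2 \<xi> \<partial>\<nu> q)"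
      using key[OF _ \<G>_sets[OF S2]] S1 by simp
    finally show "(\<integral>\<^sup>+\<xi>\<in>S1. ?H \<xi> * emeasure (\<kappa> \<xi>) S2 \<partial>\<nu> q) = (\<integral>\<^sup>+\<xi>\<in>S1. H q S2 \<xi> \<partial>\<nu> q)" .
  qed
  then have ae_\<G>: "AE \<xi> in \<nu> q. \<forall>S2\<in>\<G>. ?H \<xi> * emeasure (\<kappa> \<xi>) S2 = H q S2 \<xi>"
    using \<G>(1) by (simp add: AE_ball_countable)

  \<comment> \<open>The integral of the normaliser is the mass of \<open>\<mu>\<close>, a part of a
    probability law, so the normaliser is finite almost everywhere.\<close>
  have "(\<integral>\<^sup>+\<xi>. ?H \<xi> \<partial>\<nu> q) = (\<integral>\<^sup>+\<xi>. ?H \<xi> * indicator (space (\<nu> q)) \<xi> \<partial>\<nu> q)"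
    by (rule nn_integral_cong) simp
  also have "\<dots> = emeasure \<mu> (space \<mu>)"
    unfolding \<mu> space_density by (rule emeasure_density[OF mH[OF top] sets.top, symmetric])
  also have "\<dots> = (\<integral>\<^sup>+\<xi>. indicator S \<xi> \<partial>D)"
    unfolding \<mu>_def using S sets_D by (subst emeasure_density) (auto intro!: nn_integral_cong)
  also have "\<dots> \<le> (\<integral>\<^sup>+\<xi>. 1 \<partial>D)" by (rule nn_integral_mono) (simp split: split_indicator)
  also have "\<dots> = 1"
    using prob_space.emeasure_space_1[OF P.prob_space_distr[OF C_P]] by (simp add: D_def)
  finally have "(\<integral>\<^sup>+\<xi>. ?H \<xi> \<partial>\<nu> q) \<noteq> \<infinity>" by (auto simp: top_unique)
  then have fin: "AE \<xi> in \<nu> q. ?H \<xi> \<noteq> \<infinity>" by (rule nn_integral_PInf_AE[OF mH[OF top]])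

  \<comment> \<open>Positivity may be assumed here: it holds almost everywhere for
    \<open>\<mu>\<close>, whose density is the normaliser.\<close>
  have "AE \<xi> in \<nu> q. 0 < ?H \<xi> \<longrightarrow> regular q \<xi>"
    using ae_\<G> fin AE_\<nu>_nonneg[OF good] AE_space
  proof eventually_elim
    case (elim \<xi>)
    then have \<xi>: "\<xi> \<in> conf E C" using sets_eq_imp_space_eq[OF sets_\<nu>[of q]] by simp
    show ?case
    proof
      assume pos: "0 < ?H \<xi>"
      let ?f = "\<lambda>p. ennreal (\<rho> p) * ennreal (\<Phi> p q \<xi>) / ?H \<xi>"
      let ?R = "distr (density LI ?f) NI (\<lambda>p. p ` {..<l})"
      note m\<Phi> = measurable_\<Phi>_LI[OF q \<xi>]
      have f: "?f \<in> borel_measurable LI" using m\<Phi> by measurable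
      have img: "(\<lambda>p. p ` {..<l}) \<in> density LI ?f \<rightarrow>\<^sub>M NI"
        using measurable_image_LI unfolding measurable_cong_sets[OF sets_density refl] .
      have "\<kappa> \<xi> = ?R"
      proof (rule measure_eqI_generator_eq[OF \<G>(3,2), of _ _ "\<lambda>_. conf E I"])
        fix S2 assume S2: "S2 \<in> \<G>"
        note S2' = \<G>_sets[OF S2]
        have "emeasure ?R S2 = (\<integral>\<^sup>+p. indicator S2 p \<partial>?R)"
          using S2' by (intro nn_integral_indicator[symmetric]) simp
        also have "\<dots> = (\<integral>\<^sup>+p. indicator S2 (p ` {..<l}) \<partial>density LI ?f)"
          by (rule nn_integral_distr[OF img]) (use S2' in simp)
        also have "\<dots> = (\<integral>\<^sup>+p. ?f p * indicator S2 (p ` {..<l}) \<partial>LI)"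
          by (rule nn_integral_density[OF f measurable_compose[OF measurable_image_LI borel_measurable_indicator[OF S2']]])
        also have "\<dots> = (\<integral>\<^sup>+p. (indicator S2 (p ` {..<l}) * ennreal (\<rho> p) * ennreal (\<Phi> p q \<xi>)) / ?H \<xi> \<partial>LI)"
          by (simp add: divide_ennreal_def ac_simps)
        also have "\<dots> = H q S2 \<xi> / ?H \<xi>"
          unfolding H_def
          by (rule nn_integral_divide, intro borel_measurable_times_ennreal
              measurable_compose[OF measurable_image_LI borel_measurable_indicator[OF S2']])
            (use m\<Phi> in measurable)
        also have "H q S2 \<xi> = ?H \<xi> * emeasure (\<kappa> \<xi>) S2" using elim(1) S2 by simp
        also have "\<dots> / ?H \<xi> = emeasure (\<kappa> \<xi>) S2"
          using pos elim(2) by (simp add: ennreal_mult_divide_eq mult.commute)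
        finally show "emeasure (\<kappa> \<xi>) S2 = emeasure ?R S2" ..
      next
        interpret K: prob_space "\<kappa> \<xi>" by (rule prob_space_\<kappa>[OF \<xi>])
        show "emeasure (\<kappa> \<xi>) (conf E I) \<noteq> \<infinity>" by simp
      qed (use \<G>(4,5) sets_\<kappa>[OF \<xi>] in auto)
      then show "regular q \<xi>" using pos elim by (auto simp: regular_def)
    qed
  qed
  then have "AE \<xi> in \<mu>. regular q \<xi>"
    unfolding \<mu> by (subst AE_density[OF mH[OF top]])
  then have "AE \<xi> in D. 0 < (indicator S \<xi> :: ennreal) \<longrightarrow> regular q \<xi>"
    unfolding \<mu>_def using S sets_D by (subst (asm) AE_density) auto
  then have "AE X in P. 0 < (indicator S (X \<inter> C) :: ennreal) \<longrightarrow> regular q (X \<inter> C)"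
    unfolding D_def by (rule AE_distrD[OF C_P])
  with ae_S show ?thesis by eventually_elim auto
qed

section \<open>Choice and change of the reference tuple\<close>

text \<open>If \<rho> were positive only on a null set, the Palm formula would give the event
  probability 0. So the tuples with positive \<rho> are not null, and almost all of them are
  good.\<close>

lemma ex_good:
  assumes "0 < measure P {X \<in> space P. nparticles I X = of_nat l}"
  obtains q where "good q"
proof -
  have "AE p in L. 0 < \<rho> p \<longrightarrow> good p"
    using palm_density AE_space by eventually_elim (auto simp: good_def)
  moreover have "\<not> (AE p in L. \<not> 0 < \<rho> p)"
  proof
    assume "AE p in L. \<not> 0 < \<rho> p"
    then have ae: "AE p in LI. \<not> 0 < \<rho> p" by (rule AE_LI)
    have "fact l * emeasure P {X\<in>space P. nparticles I X = of_nat l \<and> X \<inter> C \<in> conf E C \<and> X \<inter> I \<in> conf E I} =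
        (\<integral>\<^sup>+p. emeasure (Q p) {Z\<in>space N. Z \<inter> I = {} \<and> Z \<inter> C \<in> conf E C} *
          (indicator (conf E I) (p ` {..<l}) * ennreal (\<rho> p)) \<partial>LI)"
      using sets.top[of NC] sets.top[of NI]
      by (intro palm_formula_conf_tuples I_borel I_subset compact_closure_I closure_I) auto
    also have "\<dots> = (\<integral>\<^sup>+p. 0 \<partial>LI)"
      by (rule nn_integral_cong_AE) (use ae in \<open>eventually_elim, simp add: ennreal_neg\<close>)
    also have "{X\<in>space P. nparticles I X = of_nat l \<and> X \<inter> C \<in> conf E C \<and> X \<inter> I \<in> conf E I} =
        {X \<in> space P. nparticles I X = of_nat l}"
      by (auto simp: space_P intro: conf_Int)
    finally have "emeasure P {X \<in> space P. nparticles I X = of_nat l} = 0" by simp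
    then show False using assms by (simp add: measure_def)
  qed
  ultimately have "\<exists>q. good q"
    using eventually_mono[of "\<lambda>p. 0 < \<rho> p \<longrightarrow> good p" _ "\<lambda>p. \<not> 0 < \<rho> p"] by blast
  then show ?thesis using that by blast
qed

text \<open>Passage from the fixed reference tuple \<open>r\<close> to any \<open>q\<close>: by the
  cocycle identity the two unnormalised densities are proportional, with factor
  \<open>\<Psi> r q \<xi>\<close>. The nonzero normaliser excludes the degenerate cases, namely that
  \<open>r\<close> is not admissible for \<xi> or that this factor vanishes.\<close>

lemma regular_imp_density:
  assumes reg: "regular r \<xi>" and r: "r \<in> space L" and \<xi>: "\<xi> \<in> conf E C" and q: "q \<in> conf_tuples l (E - \<xi>)"
  defines "Z \<equiv> (\<integral>p. \<Psi> p q \<xi> * \<rho> p \<partial>LI)"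
  shows "\<kappa> \<xi> = distr (density LI (\<lambda>p. ennreal (inverse Z * \<Psi> p q \<xi> * \<rho> p))) NI (\<lambda>p. p ` {..<l})"
proof -
  let ?H = "H r (conf E I) \<xi>"
  have adm_r: "adm r \<xi>"
  proof (rule ccontr)
    assume "\<not> adm r \<xi>"
    then have "?H = 0" by (simp add: H_def \<Phi>_def)
    then show False using reg by (simp add: regular_def)
  qed
  then have W: "\<xi> \<in> W" and rc: "r \<in> conf_tuples l (E - \<xi>)" by (auto simp: adm_def)
  have pc: "p \<in> conf_tuples l (E - \<xi>)" if "p \<in> conf_tuples l I" for p
    using that conf_subset[OF \<xi>] I_subset by (fastforce simp: conf_tuples_def PiE_iff)
  define d where "d = \<Psi> r q \<xi>"
  (* The factor d does not depend on p; whatever its sign, it cancels in the normalised density. *)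
  have \<Psi>: "\<Psi> p q \<xi> = \<Phi> p r \<xi> * d" if "p \<in> conf_tuples l I" for p
    using \<Psi>_cocycle[OF W pc[OF that] q rc] adm_r pc[OF that] W by (simp add: \<Phi>_def adm_def d_def)
  \<comment> \<open>A zero factor gives
    \<open>\<Psi> r r \<xi> = \<Psi> r q \<xi> * \<Psi> q r \<xi> = 0\<close>, hence
    \<open>\<Psi> p r \<xi> = \<Psi> p r \<xi> * \<Psi> r r \<xi> = 0\<close> for every tuple
    \<open>p\<close> in \<open>I\<close>, against the nonzero normaliser.\<close>
  have d: "d \<noteq> 0"
  proof
    assume "d = 0"
    then have "\<Psi> r r \<xi> = 0" using \<Psi>_cocycle[OF W rc rc q] by (simp add: d_def)
    then have "\<Phi> p r \<xi> = 0" if "p \<in> conf_tuples l I" for p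
      using \<Psi>_cocycle[OF W pc[OF that] rc rc] by (simp add: \<Phi>_def)
    then have "?H = (\<integral>\<^sup>+p. 0 \<partial>LI)" unfolding H_def by (intro nn_integral_cong) simp
    then show False using reg by (simp add: regular_def)
  qed
  define g where "g p = \<rho> p * \<Phi> p r \<xi>" for p
  have g_meas: "g \<in> borel_measurable LI"
    unfolding g_def using measurable_\<Phi>_LI[OF r \<xi>] by measurable
  have ae_nonneg: "AE p in LI. 0 \<le> g p"
  proof -
    have "AE p in LI. 0 < \<rho> p \<longrightarrow> 0 \<le> \<Phi> p r \<xi>" using reg by (simp add: regular_def)
    then show ?thesis
      using AE_space
    proof eventually_elim
      case (elim p)
      then have "0 \<le> \<rho> p" using \<rho>_nonneg space_LI_subset by simp
      \<comment> \<open>Where \<open>\<rho> p = 0\<close> the sign of \<Phi> is unknown, but the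
        product vanishes.\<close>
      then show ?case using elim(1) by (cases "\<rho> p = 0") (auto simp: g_def)
    qed
  qed
  have g_ennreal: "ennreal (g p) = ennreal (\<rho> p) * ennreal (\<Phi> p r \<xi>)" if "p \<in> conf_tuples l I" for p
    using \<rho>_nonneg[of p] space_LI_subset[OF that] by (simp add: g_def ennreal_mult')
  have H: "?H = (\<integral>\<^sup>+p. ennreal (g p) \<partial>LI)"
    unfolding H_def
  proof (rule nn_integral_cong)
    fix p assume "p \<in> space LI"
    moreover from this have "p ` {..<l} \<in> conf E I"
      using measurable_space[OF measurable_image_LI] by simp
    ultimately show "indicator (conf E I) (p ` {..<l}) * ennreal (\<rho> p) * ennreal (\<Phi> p r \<xi>) = ennreal (g p)"
      by (simp add: g_ennreal)
  qed
  define z where "z = (\<integral>p. g p \<partial>LI)"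
  \<comment> \<open>For an almost everywhere nonnegative integrand the real integral is
    \<open>enn2real\<close> of the other one. As the normaliser is finite and nonzero, the default
    value 0 for non-integrable functions does not occur.\<close>
  have z_enn: "z = enn2real ?H"
    unfolding z_def H by (rule integral_eq_nn_integral[OF g_meas ae_nonneg])
  have z: "0 < z" "?H = ennreal z"
    using reg by (auto simp: z_enn regular_def enn2real_positive_iff less_top zero_less_iff_neq_zero)
  have "Z = (\<integral>p. d * g p \<partial>LI)"
    unfolding Z_def by (rule Bochner_Integration.integral_cong) (simp_all add: \<Psi> g_def)
  also have "\<dots> = d * z" by (simp add: z_def)
  finally have Z: "Z = d * z" .
  have "density LI (\<lambda>p. ennreal (inverse Z * \<Psi> p q \<xi> * \<rho> p)) =
      density LI (\<lambda>p. ennreal (\<rho> p) * ennreal (\<Phi> p r \<xi>) / ?H)"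
  proof (rule density_cong)
    show "(\<lambda>p. ennreal (\<rho> p) * ennreal (\<Phi> p r \<xi>) / ?H) \<in> borel_measurable LI"
      using measurable_\<Phi>_LI[OF r \<xi>] by measurable
    have eq: "inverse Z * \<Psi> p q \<xi> * \<rho> p = g p / z" if "p \<in> conf_tuples l I" for p
      using d z(1) by (simp add: Z \<Psi>[OF that] g_def field_simps)
    have "(\<lambda>p. ennreal (g p / z)) \<in> borel_measurable LI" using g_meas by measurable
    then show "(\<lambda>p. ennreal (inverse Z * \<Psi> p q \<xi> * \<rho> p)) \<in> borel_measurable LI"
      by (subst measurable_cong[where g="\<lambda>p. ennreal (g p / z)"]) (simp_all add: eq)
    show "AE p in LI. ennreal (inverse Z * \<Psi> p q \<xi> * \<rho> p) = ennreal (\<rho> p) * ennreal (\<Phi> p r \<xi>) / ?H"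
      using ae_nonneg AE_space
    proof eventually_elim
      case (elim p)
      then have p: "p \<in> conf_tuples l I" by simp
      have "ennreal (inverse Z * \<Psi> p q \<xi> * \<rho> p) = ennreal (g p) / ennreal z"
        using elim(1) z(1) by (simp add: eq[OF p] divide_ennreal)
      then show ?case by (simp add: g_ennreal[OF p] z(2))
    qed
  qed
  then show ?thesis using reg by (simp add: regular_def)
qed

end

theorem proposition3p1:
  fixes E I :: "'a::euclidean_space set"
    and P :: "'a set measure"
    and \<rho> :: "nat \<Rightarrow> (nat \<Rightarrow> 'a) \<Rightarrow> real"
    and palm :: "nat \<Rightarrow> (nat \<Rightarrow> 'a) \<Rightarrow> 'a set measure"
    and W :: "'a set set"
    and \<Psi> :: "nat \<Rightarrow> (nat \<Rightarrow> 'a) \<Rightarrow> (nat \<Rightarrow> 'a) \<Rightarrow> 'a set \<Rightarrow> real"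
    and \<kappa> :: "'a set \<Rightarrow> 'a set measure"
    and l :: nat
  assumes "open E" and "point_process E P" and "rigid E P"
    and A_density: "\<And>k. k > 0 \<Longrightarrow>
      correlation_measure E P k (density (leb_tuples k E) (\<lambda>p. ennreal (\<rho> k p)))"
    and A_nonneg: "\<And>k p. k > 0 \<Longrightarrow> p \<in> {..<k} \<rightarrow>\<^sub>E E \<Longrightarrow> 0 \<le> \<rho> k p"
    and A_symmetric: "\<And>k p \<pi>. k > 0 \<Longrightarrow> p \<in> {..<k} \<rightarrow>\<^sub>E E \<Longrightarrow> \<pi> permutes {..<k} \<Longrightarrow>
      \<rho> k (p \<circ> \<pi>) = \<rho> k p"
    and A_continuous: "\<And>k. k > 0 \<Longrightarrow> continuous_on ({..<k} \<rightarrow>\<^sub>E E) (\<rho> k)"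
    and palm: "\<And>k. k > 0 \<Longrightarrow> reduced_palm E P k (\<rho> k) (palm k)"
    and B_borel: "W \<in> sets (conf_space E E)"
    and B_tail: "W \<in> tail_algebra E"
    and B_measurable: "\<And>k. k > 0 \<Longrightarrow>
      (\<lambda>(p, q, X). \<Psi> k p q X) \<in> borel_measurable
        (restrict_space (leb_tuples k E \<Otimes>\<^sub>M leb_tuples k E \<Otimes>\<^sub>M conf_space E E)
          {(p, q, X). X \<in> W \<and> p \<in> conf_tuples k (E - X) \<and> q \<in> conf_tuples k (E - X)})"
    and B_1: "emeasure P W = 1"
    and B_2: "\<And>k X. k > 0 \<Longrightarrow> X \<in> W \<Longrightarrow>
      continuous_on (conf_tuples k (E - X) \<times> conf_tuples k (E - X)) (\<lambda>(p, q). \<Psi> k p q X)"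
    and B_3: "\<And>k X p q r. k > 0 \<Longrightarrow> X \<in> W \<Longrightarrow> p \<in> conf_tuples k (E - X) \<Longrightarrow>
      q \<in> conf_tuples k (E - X) \<Longrightarrow> r \<in> conf_tuples k (E - X) \<Longrightarrow>
      \<Psi> k p q X = \<Psi> k p r X * \<Psi> k r q X"
    and B_4: "\<And>k. k > 0 \<Longrightarrow> palm_derivative E P k (\<rho> k) (palm k) (\<Psi> k)"
    and "open I" and "compact (closure I)" and "closure I \<subseteq> E"
    and "l > 0"
    and "measure P {X \<in> space P. nparticles I X = of_nat l} > 0"
    and "conditional_measures E P (E - I) \<kappa>"
  shows "AE X in P. nparticles I X = of_nat l \<longrightarrow>
    (AE q in leb_tuples l E. q \<in> conf_tuples l (E - X \<inter> (E - I)) \<longrightarrow>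
      (let Z = (\<integral>p. \<Psi> l p q (X \<inter> (E - I)) * \<rho> l p \<partial>leb_conf_tuples l I) in
        \<kappa> (X \<inter> (E - I)) =
          distr
            (density (leb_conf_tuples l I)
              (\<lambda>p. ennreal (inverse Z * \<Psi> l p q (X \<inter> (E - I)) * \<rho> l p)))
            (conf_space E I) (\<lambda>p. p ` {..<l})))"
proof -
  interpret rigid_quasi_symmetric_process E P l "\<rho> l" "palm l" W "\<Psi> l" I \<kappa>
  proof unfold_locales
    show "\<rho> l \<in> borel_measurable (leb_tuples l E)"
      by (rule continuous_on_imp_measurable_leb_tuples[OF A_continuous[OF \<open>l > 0\<close>]])
  qed (fact assms palm[OF \<open>l > 0\<close>] B_measurable[OF \<open>l > 0\<close>] B_3[OF \<open>l > 0\<close>] B_4[OF \<open>l > 0\<close>]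
      A_nonneg[OF \<open>l > 0\<close>])+
  \<comment> \<open>One tuple \<open>r\<close> serves all \<open>X\<close> and \<open>q\<close>: the
    exceptional set of configurations belongs to \<open>r\<close> alone, and every admissible
    \<open>q\<close> is reached through the cocycle identity.\<close>
  obtain r where r: "good r"
    using ex_good assms by blast
  show ?thesis
    using AE_regular[OF r] AE_space
  proof eventually_elim
    case (elim X)
    have "X \<inter> (E - I) \<in> conf E (E - I)" using elim(2) by (auto simp: space_P intro: conf_Int)
    moreover have "r \<in> space (leb_tuples l E)" using r by (simp add: good_def)
    ultimately show ?case
      using regular_imp_density elim(1) unfolding Let_def by blast
  qed
qed

end
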